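(* Let $R$ be a finite group and let $N$ be a non-identity proper normal subgroup of $R$. Then the set $$\{S\subseteq R \mid S=S^{-1},\ R=\mathbf{N}_{\mathrm{Aut}(\Gamma(R,S))}(R),\ \exists f\in \mathbf{N}_{\mathrm{Aut}(\Gamma(R,S))}(N)\text{ with } f\ne 1\text{ and }1^f=1\}$$ has cardinality at most $2^{\mathbf{c}(R)-\frac{|N|}{96}+2\log_2|R|+(\log_2|R|)^2+3}$. Moreover, if $R$ is neither abelian of exponent greater than $2$ nor generalised dicyclic, then the same upper bound holds for the set obtained by dropping the condition $R=\mathbf{N}_{\mathrm{Aut}(\Gamma(R,S))}(R)$ from the definition of the set.
   Context: For a finite group $R$ and an inverse-closed subset $S=S^{-1}\subseteq R$, the Cayley graph $\Gamma(R,S)$ has vertex set $R$ and $\{r,t\}$ is an edge if and only if $tr^{-1}\in S$. $\mathrm{Aut}(\Gamma(R,S))$ is the group of permutations of $R$ preserving the edge set. $R$ is identified with its right regular representation, a regular subgroup of $\mathrm{Aut}(\Gamma(R,S))$; correspondingly a subgroup $N\le R$ is identified with a subgroup of $\mathrm{Aut}(\Gamma(R,S))$ (acting by right multiplication). $\mathbf{N}_G(H)$ denotes the normaliser of $H$ in $G$. For a permutation $f$ of $R$ and $x\in R$, $x^f$ is the image of $x$ under $f$; in "$1^f=1$", $1$ is the vertex given by the identity element of $R$. Let $\mathbf{I}(R)=\{x\in R\mid o(x)\le 2\}$, where $o(x)$ is the order of $x$, and $\mathbf{c}(R)=\frac{|R|+|\mathbf{I}(R)|}{2}$. A group is generalised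 dicyclic if it is isomorphic to $\mathrm{Dic}(A,y,x)=\langle A,x\mid x^2=y,\ a^x=a^{-1}\ \forall a\in A\rangle$ for some abelian group $A$ of even order and exponent greater than $2$ and some involution $y\in A$. *)

theory Defs
  imports Complex_Main "HOL-Algebra.Algebra"
begin

definition cayley_edges :: "('a, 'b) monoid_scheme \<Rightarrow> 'a set \<Rightarrow> 'a set set" where
  "cayley_edges R S =
     {{r, t} | r t. r \<in> carrier R \<and> t \<in> carrier R \<and> t \<otimes>\<^bsub>R\<^esub> inv\<^bsub>R\<^esub> r \<in> S}"

text \<open>
  Loops are allowed: \<open>{r, r} = {r}\<close> is an edge iff \<open>S\<close> contains the identity.
  The product of \<^const>\<open>BijGroup\<close> is \<open>g \<circ> f\<close> (first \<open>f\<close>, then \<open>g\<close>), opposite to the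
  product of permutations written as exponents; subgroups and normalisers are the same for
  both products.
\<close>

definition cayley_aut :: "('a, 'b) monoid_scheme \<Rightarrow> 'a set \<Rightarrow> ('a \<Rightarrow> 'a) monoid" where
  "cayley_aut R S =
     BijGroup (carrier R)
       \<lparr>carrier := {f \<in> Bij (carrier R). ((`) f) ` cayley_edges R S = cayley_edges R S}\<rparr>"

definition right_regular :: "('a, 'b) monoid_scheme \<Rightarrow> 'a set \<Rightarrow> ('a \<Rightarrow> 'a) set" where
  "right_regular R N = {\<lambda>r \<in> carrier R. r \<otimes>\<^bsub>R\<^esub> x | x. x \<in> N}"

definition elements_ord_le2 :: "('a, 'b) monoid_scheme \<Rightarrow> 'a set" where
  "elements_ord_le2 R = {x \<in> carrier R. group.ord R x \<le> 2}"

definition c_value :: "('a, 'b) monoid_scheme \<Rightarrow> real" where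
  "c_value R = (real (order R) + real (card (elements_ord_le2 R))) / 2"

text \<open>Only meaningful if some positive \<open>n\<close> works, e.g. for finite groups.\<close>

definition group_exponent :: "('a, 'b) monoid_scheme \<Rightarrow> nat" where
  "group_exponent G = (LEAST n. n > 0 \<and> (\<forall>x \<in> carrier G. x [^]\<^bsub>G\<^esub> n = \<one>\<^bsub>G\<^esub>))"

text \<open>
  Group presentations. A letter \<open>(True, x)\<close> stands for the generator \<open>x\<close> and
  \<open>(False, x)\<close> for its formal inverse. The presented group consists of the words in the
  generators \<open>gens\<close>, modulo the least congruence containing the relations and cancelling
  adjacent inverse letters. The relations are assumed to be pairs of words in \<open>gens\<close>.
\<close>

type_synonym 'g word = "(bool \<times> 'g) list"

definition words :: "'g set \<Rightarrow> 'g word set" where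
  "words gens = {w. snd ` set w \<subseteq> gens}"

inductive_set pres_cong :: "'g set \<Rightarrow> ('g word \<times> 'g word) set \<Rightarrow> ('g word \<times> 'g word) set"
  for gens :: "'g set" and rels :: "('g word \<times> 'g word) set" where
  relation: "(u, v) \<in> rels \<Longrightarrow> (u, v) \<in> pres_cong gens rels"
| cancel: "x \<in> gens \<Longrightarrow> ([(b, x), (\<not> b, x)], []) \<in> pres_cong gens rels"
| refl: "u \<in> words gens \<Longrightarrow> (u, u) \<in> pres_cong gens rels"
| sym: "(u, v) \<in> pres_cong gens rels \<Longrightarrow> (v, u) \<in> pres_cong gens rels"
| trans: "(u, v) \<in> pres_cong gens rels \<Longrightarrow> (v, w) \<in> pres_cong gens rels \<Longrightarrow> (u, w) \<in> pres_cong gens rels"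
| append: "(u, u') \<in> pres_cong gens rels \<Longrightarrow> (v, v') \<in> pres_cong gens rels
    \<Longrightarrow> (u @ v, u' @ v') \<in> pres_cong gens rels"

definition presented_group :: "'g set \<Rightarrow> ('g word \<times> 'g word) set \<Rightarrow> 'g word set monoid" where
  "presented_group gens rels =
     \<lparr>carrier = words gens // pres_cong gens rels,
      monoid.mult = (\<lambda>U V. \<Union>u \<in> U. \<Union>v \<in> V. pres_cong gens rels `` {u @ v}),
      monoid.one = pres_cong gens rels `` {[]}\<rparr>"

text \<open>
  \<open>Dic A y\<close> is the group \<open>\<langle>A, x | x\<^sup>2 = y, a\<^sup>x = a\<^sup>-\<^sup>1 for all a in A\<rangle>\<close>, where \<open>a\<^sup>x\<close> is
  \<open>x\<^sup>-\<^sup>1 a x\<close>. The generators are \<open>Some a\<close> for \<open>a\<close> in \<open>A\<close>, and \<open>None\<close> for \<open>x\<close>;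
  having \<open>A\<close> to the left of the bar includes the multiplication table of \<open>A\<close> among the
  relations.
\<close>

definition dic_generators :: "('a, 'b) monoid_scheme \<Rightarrow> 'a option set" where
  "dic_generators A = insert None (Some ` carrier A)"

definition dic_relations ::
    "('a, 'b) monoid_scheme \<Rightarrow> 'a \<Rightarrow> ('a option word \<times> 'a option word) set" where
  "dic_relations A y =
     {([(True, Some a), (True, Some b)], [(True, Some (a \<otimes>\<^bsub>A\<^esub> b))]) | a b.
        a \<in> carrier A \<and> b \<in> carrier A}
     \<union> {([(True, None), (True, None)], [(True, Some y)])}
     \<union> {([(False, None), (True, Some a), (True, None)], [(False, Some a)]) | a. a \<in> carrier A}"

definition Dic :: "('a, 'b) monoid_scheme \<Rightarrow> 'a \<Rightarrow> 'a option word set monoid" where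
  "Dic A y = presented_group (dic_generators A) (dic_relations A y)"

text \<open>
  Taking \<open>A\<close> over the element type of \<open>G\<close> is no restriction: \<open>A\<close> embeds into \<open>Dic A y\<close>,
  hence is isomorphic to a subgroup of any group isomorphic to \<open>Dic A y\<close>.
\<close>

definition generalised_dicyclic :: "('a, 'b) monoid_scheme \<Rightarrow> bool" where
  "generalised_dicyclic G \<longleftrightarrow>
     (\<exists>(A :: 'a monoid) y. comm_group A \<and> finite (carrier A) \<and> even (order A) \<and>
        group_exponent A > 2 \<and> y \<in> carrier A \<and> group.ord A y = 2 \<and> G \<cong> Dic A y)"

end

theory Submission
  imports Defs
begin

text \<open>
  Let \<open>f\<close> be a nontrivial element of the normaliser of \<open>N\<close> that fixes \<open>1\<close>. Normalising the right
  translations by \<open>N\<close> means that \<open>f (r n) = f r f n\<close> for all \<open>r \<in> R\<close> and \<open>n \<in> N\<close>. For every \<open>b\<close>, the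
  recentred map \<open>g z = f (z b) (f b)\<^sup>-\<^sup>1\<close> is again an automorphism of the graph that fixes \<open>1\<close>; so
  \<open>g\<close> preserves the neighbourhood \<open>S\<close> of \<open>1\<close>, and \<open>g (x n) = g x \<phi> n\<close> for an endomorphism \<open>\<phi>\<close>
  of \<open>N\<close>. The proof is a dichotomy on these maps \<open>g\<close>.

  \<^item> Some \<open>g\<close> sends some \<open>x\<close> to an element \<open>y\<close> outside \<open>{x, x\<^sup>-\<^sup>1}\<close>. Then \<open>S\<close> is a union of classes of
    an equivalence relation that identifies every \<open>z\<close> with \<open>z\<^sup>-\<^sup>1\<close> and every \<open>x n\<close> with \<open>y \<phi> n\<close>. The
    first identification alone leaves \<open>c(R)\<close> classes. For \<open>n\<close> in a set of at least \<open>|N| / 20\<close>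
    elements, \<open>y \<phi> n\<close> lies outside \<open>{x n, (x n)\<^sup>-\<^sup>1}\<close> (\<open>card_moved_points\<close>), and this merges enough
    inversion orbits to leave at most \<open>c(R) - |N| / 80\<close> classes (\<open>card_classes_le\<close>). As \<open>N\<close> has
    at most \<open>log 2 |N|\<close> generators, there are at most \<open>2 powr (log 2 |N|)\<^sup>2\<close> choices of \<open>\<phi>\<close>; with
    the choices of \<open>x\<close> and \<open>y\<close> this gives the bound (\<open>card_sets_with_moving_map\<close>).

  \<^item> Otherwise \<open>f (a b)\<close> is \<open>a f b\<close> or \<open>a\<^sup>-\<^sup>1 f b\<close> for all \<open>a\<close> and \<open>b\<close>, that is, \<open>f\<close> preserves every
    undirected Cayley graph of \<open>R\<close>. Such an \<open>f \<noteq> 1\<close> exists only if \<open>R\<close> is abelian of exponent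
    greater than \<open>2\<close> or generalised dicyclic (\<open>colour_preserving_map\<close>). These groups are excluded in the second
    bound. They also have a nontrivial automorphism that sends every element to itself or to
    its inverse; it normalises \<open>R\<close> in every graph, so that the first set is empty.
\<close>

section \<open>Counting unions of equivalence classes\<close>

lemma card_family_le_classes:
  assumes "finite Y" and "equiv Y E"
    and sub: "\<And>S. S \<in> F \<Longrightarrow> S \<subseteq> Y"
    and sat: "\<And>S a b. S \<in> F \<Longrightarrow> (a, b) \<in> E \<Longrightarrow> a \<in> S \<Longrightarrow> b \<in> S"
  shows "card F \<le> 2 ^ card (Y // E)"
proof -
  define blocks where "blocks S = {K \<in> Y // E. K \<subseteq> S}" for S
  have fin: "finite (Y // E)"
    using assms(1,2) by (simp add: equiv_type finite_quotient)
  have union_blocks: "\<Union> (blocks S) = S" if "S \<in> F" for S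
  proof
    show "S \<subseteq> \<Union> (blocks S)"
    proof
      fix a assume "a \<in> S"
      then have "a \<in> Y" using sub that by blast
      moreover have "E `` {a} \<subseteq> S" using sat that \<open>a \<in> S\<close> by blast
      ultimately show "a \<in> \<Union> (blocks S)"
        using equiv_class_self[OF assms(2)] quotientI[of a Y E] unfolding blocks_def by blast
    qed
  qed (auto simp: blocks_def)
  have "inj_on blocks F"
    by (rule inj_onI) (metis union_blocks)
  moreover have "blocks ` F \<subseteq> Pow (Y // E)"
    by (auto simp: blocks_def)
  ultimately have "card F \<le> card (Pow (Y // E))"
    using fin by (intro card_inj_on_le) auto
  then show ?thesis using fin by (simp add: card_Pow)
qed

text \<open>
  Here \<open>s\<close> is an involution on \<open>Y\<close> whose orbits lie inside the classes, and \<open>g\<close> witnesses, for the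
  points of \<open>B\<close>, that their class contains a second orbit. Give a point the weight \<open>1\<close> divided by
  the size of its orbit. The total weight is the right-hand side, and the weight of a class is its
  number of orbits. A class that meets \<open>B\<close> has weight at least \<open>2\<close>, and also at least half its size
  because every weight is at least \<open>1/2\<close>; the mean of these two estimates is at least
  \<open>1 + |B \<inter> K| / 4\<close>.
\<close>
lemma card_classes_le:
  fixes s :: "'a \<Rightarrow> 'a"
  assumes "finite Y" and E: "equiv Y E"
    and s: "\<And>x. x \<in> Y \<Longrightarrow> s x \<in> Y \<and> s (s x) = x \<and> (x, s x) \<in> E"
    and B: "B \<subseteq> Y" and g: "\<And>b. b \<in> B \<Longrightarrow> (b, g b) \<in> E \<and> g b \<noteq> b \<and> g b \<noteq> s b"
  shows "real (card (Y // E)) + real (card B) / 4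
           \<le> (real (card Y) + real (card {x \<in> Y. s x = x})) / 2"
proof -
  define w :: "'a \<Rightarrow> real" where "w x = (if s x = x then 1 else 1 / 2)" for x
  have fin: "finite (Y // E)"
    using assms(1) E by (simp add: equiv_type finite_quotient)
  have finK: "finite K" if "K \<in> Y // E" for K
    using that assms(1) E by (meson finite_subset in_quotient_imp_subset)
  have orbit: "sum w {x, s x} = 1" if "x \<in> Y" for x
    using s[OF that] by (cases "s x = x") (auto simp: w_def)
  have class_weight: "1 + real (card (B \<inter> K)) / 4 \<le> sum w K" if K: "K \<in> Y // E" for K
  proof -
    have KY: "K \<subseteq> Y" using K E by (meson in_quotient_imp_subset)
    have closed: "b \<in> K" if "a \<in> K" "(a, b) \<in> E" for a b
      using K E that by (meson in_quotient_imp_closed)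
    have pos: "0 \<le> w x" for x by (simp add: w_def)
    have orb_sub: "{x, s x} \<subseteq> K" if "x \<in> K" for x
      using that closed s KY by blast
    have half: "real (card K) / 2 \<le> sum w K"
    proof -
      have "(\<Sum>x\<in>K. (1/2::real)) \<le> sum w K"
        by (rule sum_mono) (simp add: w_def)
      then show ?thesis by simp
    qed
    show ?thesis
    proof (cases "B \<inter> K = {}")
      case True
      obtain x where "x \<in> K" using K E by (metis in_quotient_imp_non_empty ex_in_conv)
      then have "sum w {x, s x} \<le> sum w K"
        using orb_sub finK[OF K] pos by (intro sum_mono2) auto
      then show ?thesis using True orbit KY \<open>x \<in> K\<close> by auto
    next
      case False
      then obtain b where b: "b \<in> B" "b \<in> K" by blast
      define c where "c = g b"
      have c: "c \<in> K" "c \<noteq> b" "c \<noteq> s b"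
        using g[OF b(1)] closed b(2) by (auto simp: c_def)
      have "{b, s b} \<inter> {c, s c} = {}"
      proof -
        have "s (s b) = b" "s (s c) = c" using s KY b(2) c(1) by blast+
        then show ?thesis using c(2,3) by auto
      qed
      then have "sum w ({b, s b} \<union> {c, s c}) = sum w {b, s b} + sum w {c, s c}"
        by (intro sum.union_disjoint) auto
      also have "\<dots> = 2"
        using orbit[OF subsetD[OF KY b(2)]] orbit[OF subsetD[OF KY c(1)]] by linarith
      finally have "2 \<le> sum w K"
        using sum_mono2[OF finK[OF K], of "{b, s b} \<union> {c, s c}" w] orb_sub[OF b(2)] orb_sub[OF c(1)] pos
        by auto
      moreover have "card (B \<inter> K) \<le> card K" using finK[OF K] by (simp add: card_mono)
      ultimately show ?thesis using half by linarith
    qed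
  qed
  have split: "sum h Y = (\<Sum>K\<in>Y // E. sum h K)" for h :: "'a \<Rightarrow> real"
    using sum.Union_disjoint[of "Y // E" h] finK quotient_disj[OF E] Union_quotient[OF E]
    by auto
  have "real (card B) = (\<Sum>x\<in>Y. if x \<in> B then 1 else 0)"
    using B assms(1) by (simp add: sum.If_cases Int_absorb1)
  also have "\<dots> = (\<Sum>K\<in>Y // E. real (card (B \<inter> K)))"
    unfolding split using finK by (intro sum.cong) (auto simp: sum.If_cases Int_commute)
  finally have cardB: "real (card B) = (\<Sum>K\<in>Y // E. real (card (B \<inter> K)))" .
  have "real (card (Y // E)) + real (card B) / 4 = (\<Sum>K\<in>Y // E. 1 + real (card (B \<inter> K)) / 4)"
    by (simp add: sum.distrib cardB sum_divide_distrib)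
  also have "\<dots> \<le> (\<Sum>K\<in>Y // E. sum w K)"
    by (rule sum_mono) (rule class_weight)
  also have "\<dots> = sum w Y" by (simp only: split)
  also have "w = (\<lambda>x. 1/2 + (if s x = x then 1/2 else 0))" by (auto simp: w_def)
  also have "sum \<dots> Y = (real (card Y) + real (card {x \<in> Y. s x = x})) / 2"
    using assms(1) by (simp add: sum.distrib sum.If_cases Int_def)
  finally show ?thesis .
qed

context group
begin

section \<open>Maps that invert most of a group\<close>

text \<open>
  By Lagrange's theorem, the index is an integer less than \<open>2\<close>.
\<close>
lemma subgroup_more_than_half:
  assumes "subgroup K G" "finite K" "subgroup H G" "H \<subseteq> K" "card K < 2 * card H"
  shows "H = K"
proof -
  interpret K: group "G\<lparr>carrier := K\<rparr>" using assms(1) by (rule subgroup_imp_group)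
  have "subgroup H (G\<lparr>carrier := K\<rparr>)"
    using assms(1,3,4) by (simp add: subgroup_incl)
  then have "card H dvd card K"
    using K.lagrange[of H] by (simp add: order_def) (metis dvd_triv_right)
  then obtain m where m: "card K = card H * m" by (rule dvdE)
  moreover have "card K > 0" using assms(1,2) subgroup.one_closed card_gt_0_iff by blast
  moreover have "card H * m < card H * 2" using m assms(5) by simp
  ultimately have "m = 1" by (cases "m = 0") auto
  then show ?thesis using m assms(2,4) by (simp add: card_subset_eq)
qed

lemma closed_subset_more_than_half:
  assumes K: "subgroup K G" "finite K" and "U \<subseteq> K" "card K < 2 * card U"
    and closed: "\<And>a b. a \<in> U \<Longrightarrow> b \<in> U \<Longrightarrow> a \<otimes> b \<in> U"
  shows "U = K"
proof (rule subgroup_more_than_half[OF K _ assms(3,4)])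
  have U: "U \<subseteq> carrier G" "finite U" "U \<noteq> {}"
    using assms(3,4) subgroup.subset[OF K(1)] finite_subset[OF assms(3) K(2)] by auto
  show "subgroup U G"
  proof (rule subgroupI)
    show "U \<subseteq> carrier G" "U \<noteq> {}" using U by auto
    fix a assume a: "a \<in> U"
    have inj: "inj_on ((\<otimes>) a) U" using inj_on_cmult U a by (blast intro: inj_on_subset)
    then have img: "(\<otimes>) a ` U = U"
      using endo_inj_surj[OF U(2)] closed a by blast
    then obtain e where e: "e \<in> U" "a \<otimes> e = a" using a by (metis imageE)
    then have "e = \<one>" using U a by (metis l_cancel_one subsetD)
    then obtain b where "b \<in> U" "a \<otimes> b = \<one>" using img e by (metis imageE)
    then show "inv a \<in> U" using U a by (metis inv_equality inv_comm subsetD)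
  qed (use closed in auto)
qed

lemma commute_mult:
  assumes "k \<in> carrier G" "a \<in> carrier G" "b \<in> carrier G" "k \<otimes> a = a \<otimes> k" "k \<otimes> b = b \<otimes> k"
  shows "k \<otimes> (a \<otimes> b) = a \<otimes> b \<otimes> k"
proof -
  have "k \<otimes> (a \<otimes> b) = k \<otimes> a \<otimes> b" using assms(1-3) by (simp add: m_assoc)
  also have "\<dots> = a \<otimes> (k \<otimes> b)" using assms(1-4) by (simp add: m_assoc)
  also have "\<dots> = a \<otimes> b \<otimes> k" using assms(1-3,5) by (simp add: m_assoc)
  finally show ?thesis .
qed

lemma centralised_by_more_than_half:
  assumes K: "subgroup K G" "finite K" and k: "k \<in> carrier G"
    and "card K < 2 * card {l \<in> K. k \<otimes> l = l \<otimes> k}"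
    and "l \<in> K"
  shows "k \<otimes> l = l \<otimes> k"
proof -
  have "{l \<in> K. k \<otimes> l = l \<otimes> k} = K"
  proof (rule closed_subset_more_than_half[OF K _ assms(4)])
    fix a b assume "a \<in> {l \<in> K. k \<otimes> l = l \<otimes> k}" "b \<in> {l \<in> K. k \<otimes> l = l \<otimes> k}"
    then have *: "a \<in> K" "b \<in> K" "k \<otimes> a = a \<otimes> k" "k \<otimes> b = b \<otimes> k" by auto
    then have c: "a \<in> carrier G" "b \<in> carrier G" using K subgroup.mem_carrier by metis+
    have "k \<otimes> (a \<otimes> b) = a \<otimes> b \<otimes> k"
      using * c k by (intro commute_mult)
    then show "a \<otimes> b \<in> {l \<in> K. k \<otimes> l = l \<otimes> k}"
      using * K by (auto simp: subgroup.m_closed)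
  qed auto
  then show ?thesis using assms(5) by blast
qed

text \<open>
  The classical fact that an automorphism which inverts more than three quarters of a finite
  group inverts all of it, in a form with a shift. If \<open>c\<^sub>0\<close> is one solution and \<open>v = w \<phi>(c\<^sub>0)\<close>, then
  \<open>c\<^sub>0 d\<close> is a solution iff \<open>d\<close> lies in the set \<open>V\<close> of those \<open>d\<close> with \<open>\<phi> d = v\<^sup>-\<^sup>1 d\<^sup>-\<^sup>1 v\<close>. Since \<open>V\<close>
  misses less than a quarter of \<open>K\<close>, for \<open>k \<in> V\<close> more than half of all \<open>l \<in> K\<close> have both \<open>l\<close> and \<open>k l\<close>
  in \<open>V\<close>; for these \<open>k l = l k\<close>, so \<open>k\<close> is central in \<open>K\<close>. Hence \<open>V\<close> is closed under products and,
  being larger than half of \<open>K\<close>, is equal to \<open>K\<close>.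
\<close>
lemma twisted_inversion_three_quarters:
  assumes K: "subgroup K G" "finite K"
    and \<phi>: "\<And>a. a \<in> K \<Longrightarrow> \<phi> a \<in> carrier G"
      "\<And>a b. a \<in> K \<Longrightarrow> b \<in> K \<Longrightarrow> \<phi> (a \<otimes> b) = \<phi> a \<otimes> \<phi> b"
    and z: "z \<in> carrier G" and w: "w \<in> carrier G"
    and large: "3 * card K < 4 * card {c \<in> K. z \<otimes> c \<otimes> w \<otimes> \<phi> c = \<one>}"
  shows "{c \<in> K. z \<otimes> c \<otimes> w \<otimes> \<phi> c = \<one>} = K"
proof -
  define U where "U = {c \<in> K. z \<otimes> c \<otimes> w \<otimes> \<phi> c = \<one>}"
  have KG: "\<And>a. a \<in> K \<Longrightarrow> a \<in> carrier G" using K subgroup.mem_carrier by metis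
  have "U \<noteq> {}" using large unfolding U_def by (metis card.empty mult_0_right not_less0)
  then obtain c0 where c0: "c0 \<in> U" by blast
  have c0K: "c0 \<in> K" "c0 \<in> carrier G" using c0 KG by (auto simp: U_def)
  define v where "v = w \<otimes> \<phi> c0"
  have v: "v \<in> carrier G" using w \<phi> c0K by (simp add: v_def)
  define V where "V = {d \<in> K. d \<otimes> v \<otimes> \<phi> d = v}"
  have VK: "V \<subseteq> K" by (auto simp: V_def)
  have finV: "finite V" using VK K finite_subset by blast
  have translate: "c0 \<otimes> d \<in> U \<longleftrightarrow> d \<in> V" if "d \<in> K" for d
  proof -
    have 1: "z \<otimes> c0 \<otimes> v = \<one>"
      using c0 z w c0K \<phi> by (simp add: U_def v_def m_assoc)
    have "z \<otimes> (c0 \<otimes> d) \<otimes> w \<otimes> \<phi> (c0 \<otimes> d) = z \<otimes> c0 \<otimes> (d \<otimes> v \<otimes> \<phi> d)"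
      using that KG[OF that] c0K z w \<phi> by (simp add: v_def m_assoc)
    then have "c0 \<otimes> d \<in> U \<longleftrightarrow> z \<otimes> c0 \<otimes> (d \<otimes> v \<otimes> \<phi> d) = z \<otimes> c0 \<otimes> v"
      using that c0K K 1 by (simp add: U_def subgroup.m_closed)
    also have "\<dots> \<longleftrightarrow> d \<in> V"
      using that KG[OF that] c0K z v \<phi> by (simp add: V_def)
    finally show ?thesis .
  qed
  have "(\<otimes>) c0 ` V = U"
  proof
    show "(\<otimes>) c0 ` V \<subseteq> U" using translate VK by auto
    show "U \<subseteq> (\<otimes>) c0 ` V"
    proof
      fix u assume u: "u \<in> U"
      then have uK: "u \<in> K" by (simp add: U_def)
      define d where "d = inv c0 \<otimes> u"
      have d: "d \<in> K" "c0 \<otimes> d = u"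
        using c0K K uK KG[OF uK] by (auto simp: d_def subgroup.m_closed subgroup.m_inv_closed m_assoc[symmetric])
      then show "u \<in> (\<otimes>) c0 ` V" using translate[OF d(1)] u by (metis imageI)
    qed
  qed
  moreover have "inj_on ((\<otimes>) c0) V"
    using inj_on_cmult[OF c0K(2)] VK KG by (blast intro: inj_on_subset)
  ultimately have cardV: "card V = card U" using card_image by metis
  then have largeV: "3 * card K < 4 * card V" using large by (simp add: U_def)
  have central: "k \<otimes> l = l \<otimes> k" if k: "k \<in> V" and l: "l \<in> K" for k l
  proof (rule centralised_by_more_than_half[OF K _ _ l])
    have kK: "k \<in> K" "k \<in> carrier G" using k VK KG by auto
    then show "k \<in> carrier G" by simp
    define W where "W = {l \<in> V. k \<otimes> l \<in> V}"
    \<comment> \<open>Multiplication by \<open>k\<close> embeds \<open>V - W\<close> into \<open>K - V\<close>.\<close>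
    have "card V - card W \<le> card K - card V"
    proof -
      have "(\<otimes>) k ` (V - W) \<subseteq> K - V"
        using kK K VK by (auto simp: W_def subgroup.m_closed)
      moreover have "inj_on ((\<otimes>) k) (V - W)"
        using inj_on_cmult[OF kK(2)] VK KG by (blast intro: inj_on_subset)
      ultimately have "card (V - W) \<le> card (K - V)"
        using K by (intro card_inj_on_le) auto
      then show ?thesis
        using card_Diff_subset[of W V] card_Diff_subset[OF finV VK] finV
        by (auto simp: W_def)
    qed
    then have "card K < 2 * card W" using largeV by linarith
    moreover have "W \<subseteq> {l \<in> K. k \<otimes> l = l \<otimes> k}"
    proof
      fix l assume "l \<in> W"
      then have l: "l \<in> V" "l \<in> K" "l \<in> carrier G" "k \<otimes> l \<in> V" using VK KG by (auto simp: W_def)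
      have cl: "\<phi> k \<in> carrier G" "\<phi> l \<in> carrier G" using \<phi> kK l by auto
      have "k \<otimes> l \<otimes> v \<otimes> (\<phi> k \<otimes> \<phi> l) = v"
        using l(4) \<phi>(2)[OF kK(1) l(2)] by (simp add: V_def)
      also have "v = l \<otimes> (k \<otimes> v \<otimes> \<phi> k) \<otimes> \<phi> l"
        using l(1) k by (simp add: V_def)
      also have "\<dots> = l \<otimes> k \<otimes> v \<otimes> (\<phi> k \<otimes> \<phi> l)"
        using cl kK l v by (simp add: m_assoc)
      finally have "k \<otimes> l = l \<otimes> k" using cl kK l v by simp
      then show "l \<in> {l \<in> K. k \<otimes> l = l \<otimes> k}" using l by simp
    qed
    then have "card W \<le> card {l \<in> K. k \<otimes> l = l \<otimes> k}" using K by (intro card_mono) auto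
    ultimately show "card K < 2 * card {l \<in> K. k \<otimes> l = l \<otimes> k}" by linarith
  qed
  have "V = K"
  proof (rule closed_subset_more_than_half[OF K VK])
    show "card K < 2 * card V" using largeV by linarith
    fix k l assume kl: "k \<in> V" "l \<in> V"
    then have c: "k \<in> K" "l \<in> K" "k \<in> carrier G" "l \<in> carrier G" using VK KG by auto
    then have cl: "\<phi> k \<in> carrier G" "\<phi> l \<in> carrier G" using \<phi> by auto
    have "k \<otimes> l \<otimes> v \<otimes> \<phi> (k \<otimes> l) = l \<otimes> k \<otimes> v \<otimes> (\<phi> k \<otimes> \<phi> l)"
      unfolding \<phi>(2)[OF c(1,2)] unfolding central[OF kl(1) c(2)] ..
    also have "\<dots> = l \<otimes> (k \<otimes> v \<otimes> \<phi> k) \<otimes> \<phi> l" using c cl v by (simp add: m_assoc)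
    also have "\<dots> = v" using kl by (simp add: V_def)
    finally show "k \<otimes> l \<in> V" using c K by (simp add: V_def subgroup.m_closed)
  qed
  then have "card U = card K" using cardV by simp
  then show ?thesis using K unfolding U_def[symmetric]
    by (intro card_subset_eq) (auto simp: U_def)
qed

text \<open>
  The points that are not moved form \<open>F1\<close>, where \<open>y \<phi> n = x n\<close>, and \<open>F2\<close>, where
  \<open>y \<phi> n = (x n)\<^sup>-\<^sup>1\<close>; neither contains \<open>1\<close>. The set \<open>F1\<close> is empty or a coset of the group \<open>C\<close> of fixed
  points of \<open>\<phi>\<close>. By \<open>twisted_inversion_three_quarters\<close>, \<open>F2\<close> covers at most three quarters of every
  subgroup of \<open>N\<close>. If \<open>|C| \<le> |N| / 5\<close>, then \<open>1/4 - 1/5 = 1/20\<close> of \<open>N\<close> remains. If \<open>C\<close> is larger, then it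
  suffices to look inside \<open>C\<close>: it is disjoint from \<open>F1\<close>, and \<open>F2\<close> leaves a quarter of it.
\<close>
lemma card_moved_points:
  assumes N: "subgroup N G" and fin: "finite (carrier G)"
    and \<phi>: "\<And>a. a \<in> N \<Longrightarrow> \<phi> a \<in> N"
      "\<And>a b. a \<in> N \<Longrightarrow> b \<in> N \<Longrightarrow> \<phi> (a \<otimes> b) = \<phi> a \<otimes> \<phi> b"
    and x: "x \<in> carrier G" and y: "y \<in> carrier G" and "y \<noteq> x" "y \<noteq> inv x"
  shows "card N \<le> 20 * card {n \<in> N. y \<otimes> \<phi> n \<noteq> x \<otimes> n \<and> x \<otimes> n \<otimes> y \<otimes> \<phi> n \<noteq> \<one>}"
    (is "_ \<le> 20 * card ?B")
proof -
  have NG: "\<And>a. a \<in> N \<Longrightarrow> a \<in> carrier G" using N subgroup.mem_carrier by metis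
  have finN: "finite N" using fin NG by (meson finite_subset subsetI)
  have \<phi>G: "\<And>a. a \<in> N \<Longrightarrow> \<phi> a \<in> carrier G" using \<phi>(1) NG by blast
  have oneN: "\<one> \<in> N" using N by (rule subgroup.one_closed)
  have \<phi>_one: "\<phi> \<one> = \<one>"
    using \<phi>(2)[OF oneN oneN] \<phi>G[OF oneN] by (metis l_cancel_one l_one one_closed)
  define F1 where "F1 = {n \<in> N. y \<otimes> \<phi> n = x \<otimes> n}"
  define F2 where "F2 = {n \<in> N. x \<otimes> n \<otimes> y \<otimes> \<phi> n = \<one>}"
  define C where "C = {n \<in> N. \<phi> n = n}"
  have B_eq: "?B = N - F1 - F2" by (auto simp: F1_def F2_def)
  have finB: "finite ?B" using finN by simp
  have one_F1: "\<one> \<notin> F1" using assms(7) x y by (simp add: F1_def \<phi>_one)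
  \<comment> \<open>Inverses are avoided: \<open>y \<phi> n = (x n)\<^sup>-\<^sup>1\<close> reads \<open>x n y \<phi> n = 1\<close>.\<close>
  have one_F2: "x \<otimes> \<one> \<otimes> y \<otimes> \<phi> \<one> \<noteq> \<one>"
    using assms(8) x y by (simp add: \<phi>_one) (metis inv_equality inv_comm)
  have inverted: "4 * card (F2 \<inter> K) \<le> 3 * card K" if K: "subgroup K G" "K \<subseteq> N" for K
  proof (rule ccontr)
    assume "\<not> ?thesis"
    moreover have "F2 \<inter> K = {c \<in> K. x \<otimes> c \<otimes> y \<otimes> \<phi> c = \<one>}" using K(2) by (auto simp: F2_def)
    ultimately have large: "3 * card K < 4 * card {c \<in> K. x \<otimes> c \<otimes> y \<otimes> \<phi> c = \<one>}" by simp
    have "{c \<in> K. x \<otimes> c \<otimes> y \<otimes> \<phi> c = \<one>} = K"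
    proof (rule twisted_inversion_three_quarters[OF K(1) _ _ _ x y large])
      show "finite K" using K(2) finN by (rule finite_subset)
      show "\<phi> a \<in> carrier G" if "a \<in> K" for a using that K(2) \<phi>G by blast
      show "\<phi> (a \<otimes> b) = \<phi> a \<otimes> \<phi> b" if "a \<in> K" "b \<in> K" for a b using that K(2) \<phi>(2) by blast
    qed
    moreover have "\<one> \<in> K" using K(1) by (rule subgroup.one_closed)
    ultimately show False using one_F2 by blast
  qed
  have C: "subgroup C G"
  proof (rule subgroupI)
    show "C \<subseteq> carrier G" using NG by (auto simp: C_def)
    show "C \<noteq> {}" using oneN \<phi>_one by (auto simp: C_def)
    show "inv a \<in> C" if a: "a \<in> C" for a
    proof -
      have aN: "a \<in> N" "a \<in> carrier G" "inv a \<in> N" "\<phi> a = a"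
        using a N NG by (auto simp: C_def subgroup.m_inv_closed)
      have "\<phi> (inv a) \<otimes> a = \<one>" using \<phi>(2)[OF aN(3,1)] aN \<phi>_one by simp
      then have "\<phi> (inv a) = inv a" using inv_equality aN \<phi>G by metis
      then show ?thesis using aN by (simp add: C_def)
    qed
    show "a \<otimes> b \<in> C" if "a \<in> C" "b \<in> C" for a b
      using that \<phi>(2) N by (simp add: C_def subgroup.m_closed)
  qed
  have C_sub: "C \<subseteq> N" by (auto simp: C_def)
  have diff: "d \<in> C" if n: "n0 \<in> F1" "n0 \<otimes> d \<in> F1" "d \<in> N" for n0 d
  proof -
    have c: "n0 \<in> N" "n0 \<in> carrier G" "d \<in> carrier G" "\<phi> n0 \<in> carrier G" "\<phi> d \<in> carrier G"
      using n NG \<phi>G by (auto simp: F1_def)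
    have "x \<otimes> n0 \<otimes> \<phi> d = y \<otimes> \<phi> n0 \<otimes> \<phi> d" using n by (simp add: F1_def)
    also have "\<dots> = y \<otimes> \<phi> (n0 \<otimes> d)" using c n(3) y \<phi>(2) by (simp add: m_assoc)
    also have "\<dots> = x \<otimes> n0 \<otimes> d" using n(2) c x by (simp add: F1_def m_assoc)
    finally show ?thesis using c x n(3) by (simp add: C_def)
  qed
  have F1_C: "card F1 \<le> card C"
  proof (cases "F1 = {}")
    case False
    then obtain n0 where n0: "n0 \<in> F1" by blast
    then have c: "n0 \<in> N" "n0 \<in> carrier G" using NG by (auto simp: F1_def)
    have "F1 \<subseteq> (\<otimes>) n0 ` C"
    proof
      fix n assume n: "n \<in> F1"
      then have nN: "n \<in> N" "n \<in> carrier G" using NG by (auto simp: F1_def)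
      have e: "n0 \<otimes> (inv n0 \<otimes> n) = n" using c nN by (simp add: m_assoc[symmetric])
      moreover have "inv n0 \<otimes> n \<in> N" using c nN N by (simp add: subgroup.m_closed subgroup.m_inv_closed)
      ultimately have "inv n0 \<otimes> n \<in> C" using diff[OF n0] n by simp
      then show "n \<in> (\<otimes>) n0 ` C" using e by (metis imageI)
    qed
    then show ?thesis using C_sub finN finite_subset surj_card_le by metis
  qed simp
  have F1_disj: "F1 \<inter> C = {}"
  proof (rule ccontr)
    assume "F1 \<inter> C \<noteq> {}"
    then obtain c where c: "c \<in> F1" "c \<in> C" by blast
    then have cG: "c \<in> carrier G" using C subgroup.mem_carrier by metis
    have "y \<otimes> c = x \<otimes> c" using c by (simp add: F1_def C_def)
    then show False using assms(7) x y cG by simp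
  qed
  show ?thesis
  proof (cases "5 * card C \<le> card N")
    case True
    have "card N \<le> card (?B \<union> (F1 \<union> F2))"
      using finN by (intro card_mono) (auto simp: B_eq F1_def F2_def)
    also have "\<dots> \<le> card ?B + (card F1 + card F2)"
      by (meson card_Un_le le_trans nat_add_left_cancel_le)
    finally show ?thesis
      using True F1_C inverted[OF N subset_refl] by (simp add: F2_def Int_absorb2)
  next
    case False
    have "card C \<le> card (?B \<union> (F2 \<inter> C))"
      using finN F1_disj C_sub by (intro card_mono) (auto simp: B_eq F2_def)
    also have "\<dots> \<le> card ?B + card (F2 \<inter> C)" by (rule card_Un_le)
    finally show ?thesis using False inverted[OF C C_sub] by simp
  qed
qed

section \<open>Inverse-closed sets preserved by a moving map\<close>

lemma elements_ord_le2_eq: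
  assumes "finite (carrier G)"
  shows "elements_ord_le2 G = {x \<in> carrier G. inv x = x}"
proof -
  have "ord x \<le> 2 \<longleftrightarrow> inv x = x" if x: "x \<in> carrier G" for x
  proof -
    have "ord x \<ge> 1" using ord_ge_1[OF assms x] .
    then have "ord x \<le> 2 \<longleftrightarrow> ord x dvd 2"
      by (metis dvd_imp_le le_antisym not_less_eq_eq numeral_2_eq_2 one_dvd dvd_refl One_nat_def zero_less_Suc)
    also have "\<dots> \<longleftrightarrow> x [^] (2::nat) = \<one>" using pow_eq_id[OF x] by simp
    also have "\<dots> \<longleftrightarrow> x \<otimes> x = \<one>" using x by (simp add: numeral_2_eq_2)
    also have "\<dots> \<longleftrightarrow> inv x = x" using x by (metis inv_equality r_inv)
    finally show ?thesis .
  qed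
  then show ?thesis by (auto simp: elements_ord_le2_def)
qed

text \<open>
  The relation \<open>E\<close> of not being separated by a member of the family is an equivalence whose
  classes the members respect; it contains all pairs \<open>(z, z\<^sup>-\<^sup>1)\<close> and \<open>(x n, y \<phi> n)\<close>.
\<close>
lemma card_invariant_family:
  assumes N: "subgroup N G" and fin: "finite (carrier G)"
    and \<phi>: "\<And>a. a \<in> N \<Longrightarrow> \<phi> a \<in> N"
      "\<And>a b. a \<in> N \<Longrightarrow> b \<in> N \<Longrightarrow> \<phi> (a \<otimes> b) = \<phi> a \<otimes> \<phi> b"
    and x: "x \<in> carrier G" and y: "y \<in> carrier G" and "y \<noteq> x" "y \<noteq> inv x"
  shows "real (card {S. S \<subseteq> carrier G \<and> S = set_inv S \<and> (\<forall>n\<in>N. x \<otimes> n \<in> S \<longleftrightarrow> y \<otimes> \<phi> n \<in> S)})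
           \<le> 2 powr (c_value G - real (card N) / 80)"
proof -
  have NG: "\<And>a. a \<in> N \<Longrightarrow> a \<in> carrier G" using N subgroup.mem_carrier by metis
  define F where
    "F = {S. S \<subseteq> carrier G \<and> S = set_inv S \<and> (\<forall>n\<in>N. x \<otimes> n \<in> S \<longleftrightarrow> y \<otimes> \<phi> n \<in> S)}"
  define E where
    "E = {(a, b). a \<in> carrier G \<and> b \<in> carrier G \<and> (\<forall>S\<in>F. a \<in> S \<longleftrightarrow> b \<in> S)}"
  define B0 where "B0 = {n \<in> N. y \<otimes> \<phi> n \<noteq> x \<otimes> n \<and> x \<otimes> n \<otimes> y \<otimes> \<phi> n \<noteq> \<one>}"
  define B where "B = (\<otimes>) x ` B0"
  define g where "g b = y \<otimes> \<phi> (inv x \<otimes> b)" for b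
  have B0: "\<And>n. n \<in> B0 \<Longrightarrow> n \<in> N" by (simp add: B0_def)
  have equiv: "equiv (carrier G) E"
    by (rule equivI) (auto simp: E_def refl_on_def sym_on_def trans_on_def)
  have inv_E: "(a, inv a) \<in> E" if a: "a \<in> carrier G" for a
  proof -
    have "a \<in> S \<longleftrightarrow> inv a \<in> S" if "S \<in> F" for S
    proof -
      have S: "S \<subseteq> carrier G" "S = set_inv S" using that by (auto simp: F_def)
      then have "inv b \<in> S" if "b \<in> S" for b using that by (auto simp: SET_INV_def)
      then show ?thesis using a inv_inv by metis
    qed
    then show ?thesis using a by (simp add: E_def)
  qed
  have cardF: "card F \<le> 2 ^ card (carrier G // E)"
    using fin equiv by (rule card_family_le_classes) (auto simp: F_def E_def)
  have "real (card (carrier G // E)) + real (card B) / 4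
      \<le> (real (card (carrier G)) + real (card {x \<in> carrier G. inv x = x})) / 2"
  proof (rule card_classes_le[OF fin equiv])
    show "inv a \<in> carrier G \<and> inv (inv a) = a \<and> (a, inv a) \<in> E" if "a \<in> carrier G" for a
      using that inv_E by simp
    show "B \<subseteq> carrier G" using B0 NG x by (auto simp: B_def)
    show "(b, g b) \<in> E \<and> g b \<noteq> b \<and> g b \<noteq> inv b" if b: "b \<in> B" for b
    proof -
      obtain n where n: "n \<in> B0" "b = x \<otimes> n" using b by (auto simp: B_def)
      have nN: "n \<in> N" "n \<in> carrier G" "\<phi> n \<in> carrier G" using B0 NG \<phi>(1) n(1) by auto
      have "inv x \<otimes> b = n" using x nN by (simp add: n(2) m_assoc[symmetric])
      then have gb: "g b = y \<otimes> \<phi> n" by (simp add: g_def)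
      have "g b \<noteq> inv b"
      proof
        assume "g b = inv b"
        then have "y \<otimes> \<phi> n = inv (x \<otimes> n)" using gb n(2) by metis
        then have "x \<otimes> n \<otimes> (y \<otimes> \<phi> n) = \<one>" using x nN by simp
        then have "x \<otimes> n \<otimes> y \<otimes> \<phi> n = \<one>" using x y nN by (simp add: m_assoc)
        then show False using n(1) by (simp add: B0_def)
      qed
      moreover have "(x \<otimes> n, y \<otimes> \<phi> n) \<in> E" using x y nN by (auto simp: E_def F_def)
      moreover have "y \<otimes> \<phi> n \<noteq> x \<otimes> n" using n(1) by (simp add: B0_def)
      ultimately show ?thesis using gb n(2) by metis
    qed
  qed
  moreover have "card B = card B0"
    unfolding B_def using inj_on_cmult[OF x] B0 NG by (intro card_image) (blast intro: inj_on_subset)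
  moreover have "card N \<le> 20 * card B0"
    unfolding B0_def using assms by (rule card_moved_points)
  then have "real (card N) \<le> 20 * real (card B0)" by linarith
  ultimately have "real (card (carrier G // E)) \<le> c_value G - real (card N) / 80"
    unfolding c_value_def elements_ord_le2_eq[OF fin] order_def by linarith
  then have "2 powr real (card (carrier G // E)) \<le> 2 powr (c_value G - real (card N) / 80)"
    by simp
  moreover have "real (card F) \<le> 2 powr real (card (carrier G // E))"
    using of_nat_mono[where 'a = real, OF cardF] by (simp add: powr_realpow)
  ultimately show ?thesis unfolding F_def by linarith
qed

text \<open>
  Each generator that is not redundant at least doubles the subgroup generated so far.
\<close>
lemma small_generating_set:
  assumes N: "subgroup N G" and finN: "finite N"
  obtains Y where "Y \<subseteq> N" "generate G Y = N" "2 ^ card Y \<le> card N"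
proof -
  have NG: "N \<subseteq> carrier G" using N by (rule subgroup.subset)
  define good where "good Y \<longleftrightarrow> Y \<subseteq> N \<and> 2 ^ card Y \<le> card (generate G Y)" for Y
  have gen_sub: "generate G Y \<subseteq> N" if "Y \<subseteq> N" for Y
    using that N by (rule generate_subgroup_incl)
  have "generate G {} = {\<one>}" by (rule generate_empty)
  then have "good {}" by (simp add: good_def)
  moreover have "\<forall>Y. good Y \<longrightarrow> card (generate G Y) < Suc (card N)"
    using gen_sub finN card_mono unfolding good_def by (metis less_Suc_eq_le)
  ultimately obtain Y where Y: "good Y"
    and max: "\<And>Z. good Z \<Longrightarrow> card (generate G Z) \<le> card (generate G Y)"
    using ex_has_greatest_nat[of good "{}" "\<lambda>Y. card (generate G Y)" "Suc (card N)"] by auto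
  have YN: "Y \<subseteq> N" using Y by (simp add: good_def)
  have "generate G Y = N"
  proof (rule ccontr)
    assume "generate G Y \<noteq> N"
    then obtain a where a: "a \<in> N" "a \<notin> generate G Y" using gen_sub[OF YN] by blast
    define Z where "Z = insert a Y"
    have ZN: "Z \<subseteq> N" using YN a by (simp add: Z_def)
    have sub: "subgroup (generate G Y) G" "subgroup (generate G Z) G"
      using YN ZN NG by (auto intro!: generate_is_subgroup)
    have incl: "generate G Y \<subseteq> generate G Z" by (rule mono_generate) (auto simp: Z_def)
    have "a \<in> generate G Z" by (rule generate.incl) (simp add: Z_def)
    then have "generate G Y \<noteq> generate G Z" using a by blast
    moreover have finZ: "finite (generate G Z)" using gen_sub[OF ZN] finN finite_subset by blast
    ultimately have "2 * card (generate G Y) \<le> card (generate G Z)"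
      using subgroup_more_than_half[OF sub(2) _ sub(1) incl] by (meson not_le)
    moreover have "card Z \<le> Suc (card Y)" unfolding Z_def by (rule card_insert_le_m1) auto
    ultimately have "2 ^ card Z \<le> card (generate G Z)"
      using Y power_increasing[of "card Z" "Suc (card Y)" "2::nat"] by (simp add: good_def)
    then have "good Z" using ZN by (simp add: good_def)
    then have "card (generate G Z) \<le> card (generate G Y)" by (rule max)
    then show False
      using \<open>generate G Y \<noteq> generate G Z\<close> incl finZ by (simp add: card_seteq)
  qed
  then show ?thesis using that[of Y] Y by (simp add: good_def)
qed

text \<open>
  The maps are extensional, so that a finite \<open>N\<close> has only finitely many of them.
\<close>
definition endomorphisms_on :: "'a set \<Rightarrow> ('a \<Rightarrow> 'a) set" where
  "endomorphisms_on N =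
     {\<phi> \<in> N \<rightarrow>\<^sub>E N. \<forall>a\<in>N. \<forall>b\<in>N. \<phi> (a \<otimes> b) = \<phi> a \<otimes> \<phi> b}"

lemma card_endomorphisms_on:
  assumes N: "subgroup N G" and finN: "finite N"
  shows "finite (endomorphisms_on N)"
    and "real (card (endomorphisms_on N)) \<le> 2 powr (log 2 (real (card N)))\<^sup>2"
proof -
  have NG: "N \<subseteq> carrier G" using N by (rule subgroup.subset)
  show "finite (endomorphisms_on N)"
  proof (rule finite_subset)
    show "endomorphisms_on N \<subseteq> N \<rightarrow>\<^sub>E N" by (auto simp: endomorphisms_on_def)
    show "finite (N \<rightarrow>\<^sub>E N)" using finN by (intro finite_PiE) auto
  qed
  obtain Y where Y: "Y \<subseteq> N" "generate G Y = N" "2 ^ card Y \<le> card N"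
    using small_generating_set[OF N finN] by blast
  have finY: "finite Y" using Y(1) finN by (rule finite_subset)
  have pos: "card N > 0" using N finN by (metis card_gt_0_iff empty_iff subgroup.one_closed)
  have oneN: "\<one> \<in> N" using N by (rule subgroup.one_closed)
  have endo: "\<chi> a \<in> carrier G" "\<chi> (a \<otimes> b) = \<chi> a \<otimes> \<chi> b"
    if "\<chi> \<in> endomorphisms_on N" "a \<in> N" "b \<in> N" for \<chi> a b
    using that NG by (auto simp: endomorphisms_on_def)
  have endo_one: "\<chi> \<one> = \<one>" if "\<chi> \<in> endomorphisms_on N" for \<chi>
    using endo[OF that oneN oneN] by (metis l_cancel_one l_one one_closed)
  have endo_inv: "\<chi> (inv a) = inv (\<chi> a)" if \<chi>: "\<chi> \<in> endomorphisms_on N" and a: "a \<in> N" for \<chi> a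
  proof -
    have "inv a \<in> N" "a \<in> carrier G" using a N NG by (auto simp: subgroup.m_inv_closed)
    then have "\<chi> (inv a) \<otimes> \<chi> a = \<one>" "\<chi> a \<in> carrier G" "\<chi> (inv a) \<in> carrier G"
      using endo[OF \<chi>, of "inv a" a] endo(1)[OF \<chi> a a] a endo_one[OF \<chi>] by auto
    then show ?thesis using inv_equality by metis
  qed
  have agree: "\<phi> h = \<psi> h"
    if \<phi>: "\<phi> \<in> endomorphisms_on N" and \<psi>: "\<psi> \<in> endomorphisms_on N"
      and Yeq: "\<And>a. a \<in> Y \<Longrightarrow> \<phi> a = \<psi> a" and "h \<in> generate G Y" for \<phi> \<psi> h
    using that(4)
  proof (induction rule: generate.induct)
    case one
    show ?case using endo_one[OF \<phi>] endo_one[OF \<psi>] by simp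
  next
    case (incl h)
    then show ?case by (rule Yeq)
  next
    case (inv h)
    then show ?case using Yeq[OF inv] Y(1) endo_inv[OF \<phi>, of h] endo_inv[OF \<psi>, of h] by auto
  next
    case (eng h1 h2)
    then show ?case using Y(2) endo(2)[OF \<phi>, of h1 h2] endo(2)[OF \<psi>, of h1 h2] by simp
  qed
  have "inj_on (\<lambda>\<phi>. restrict \<phi> Y) (endomorphisms_on N)"
  proof (rule inj_onI)
    fix \<phi> \<psi> assume *: "\<phi> \<in> endomorphisms_on N" "\<psi> \<in> endomorphisms_on N" "restrict \<phi> Y = restrict \<psi> Y"
    have "\<phi> a = \<psi> a" if "a \<in> Y" for a using *(3) that by (metis restrict_apply')
    then have "\<phi> h = \<psi> h" if "h \<in> N" for h using agree[OF *(1,2)] that Y(2) by blast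
    then show "\<phi> = \<psi>" using *(1,2) by (auto simp: endomorphisms_on_def intro: PiE_ext)
  qed
  moreover have "(\<lambda>\<phi>. restrict \<phi> Y) ` endomorphisms_on N \<subseteq> Y \<rightarrow>\<^sub>E N"
    using Y(1) by (auto simp: endomorphisms_on_def)
  moreover have "finite (Y \<rightarrow>\<^sub>E N)" using finY finN by (simp add: finite_PiE)
  ultimately have "card (endomorphisms_on N) \<le> card (Y \<rightarrow>\<^sub>E N)"
    by (rule card_inj_on_le)
  also have "\<dots> = card N ^ card Y" using finY by (simp add: card_PiE)
  finally have "real (card (endomorphisms_on N)) \<le> real (card N) ^ card Y"
    by (metis of_nat_le_iff of_nat_power)
  also have "\<dots> = 2 powr (log 2 (real (card N)) * real (card Y))"
    using pos by (simp add: powr_powr[symmetric] powr_realpow)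
  also have "\<dots> \<le> 2 powr (log 2 (real (card N)))\<^sup>2"
  proof -
    have "(2::real) ^ card Y \<le> real (card N)" using Y(3) by (metis of_nat_le_iff of_nat_numeral of_nat_power)
    then have "real (card Y) \<le> log 2 (real (card N))" using pos by (simp add: le_log_iff powr_realpow)
    moreover have "0 \<le> log 2 (real (card N))" using pos by simp
    ultimately show ?thesis by (simp add: power2_eq_square mult_left_mono)
  qed
  finally show "real (card (endomorphisms_on N)) \<le> 2 powr (log 2 (real (card N)))\<^sup>2" .
qed

lemma card_sets_with_moving_map:
  assumes N: "subgroup N G" and fin: "finite (carrier G)"
  shows "real (card {S. S \<subseteq> carrier G \<and> S = set_inv S \<and>
            (\<exists>x\<in>carrier G. \<exists>y\<in>carrier G. \<exists>\<phi>\<in>endomorphisms_on N. y \<noteq> x \<and> y \<noteq> inv x \<and>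
               (\<forall>n\<in>N. x \<otimes> n \<in> S \<longleftrightarrow> y \<otimes> \<phi> n \<in> S))})
         \<le> 2 powr (c_value G - real (card N) / 80 + 2 * log 2 (real (order G))
                    + (log 2 (real (order G)))\<^sup>2)"
    (is "real (card ?F) \<le> _")
proof -
  have NG: "N \<subseteq> carrier G" using N by (rule subgroup.subset)
  have finN: "finite N" using NG fin by (rule finite_subset)
  define I where
    "I = {(x, y, \<phi>). x \<in> carrier G \<and> y \<in> carrier G \<and> \<phi> \<in> endomorphisms_on N \<and> y \<noteq> x \<and> y \<noteq> inv x}"
  define T where
    "T = (\<lambda>(x, y, \<phi>). {S. S \<subseteq> carrier G \<and> S = set_inv S \<and> (\<forall>n\<in>N. x \<otimes> n \<in> S \<longleftrightarrow> y \<otimes> \<phi> n \<in> S)})"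
  let ?b = "2 powr (c_value G - real (card N) / 80)"
  note endo = card_endomorphisms_on[OF N finN]
  have I_sub: "I \<subseteq> carrier G \<times> carrier G \<times> endomorphisms_on N" by (auto simp: I_def)
  have finI: "finite I" by (rule finite_subset[OF I_sub]) (use fin endo in simp)
  have T: "real (card (T i)) \<le> ?b" if "i \<in> I" for i
  proof -
    obtain x y \<phi> where i: "i = (x, y, \<phi>)" by (cases i)
    have "\<And>a. a \<in> N \<Longrightarrow> \<phi> a \<in> N" "\<And>a b. a \<in> N \<Longrightarrow> b \<in> N \<Longrightarrow> \<phi> (a \<otimes> b) = \<phi> a \<otimes> \<phi> b"
      "x \<in> carrier G" "y \<in> carrier G" "y \<noteq> x" "y \<noteq> inv x"
      using that by (auto simp: i I_def endomorphisms_on_def)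
    then show ?thesis unfolding i T_def prod.case by (rule card_invariant_family[OF N fin])
  qed
  have "?F = (\<Union>i\<in>I. T i)" by (auto simp: I_def T_def)
  then have "card ?F \<le> (\<Sum>i\<in>I. card (T i))" using card_UN_le[OF finI] by simp
  then have "real (card ?F) \<le> (\<Sum>i\<in>I. real (card (T i)))"
    by (simp only: of_nat_sum[symmetric] of_nat_le_iff)
  also have "\<dots> \<le> real (card I) * ?b" using sum_bounded_above[of I "\<lambda>i. real (card (T i))" ?b] T by simp
  also have "\<dots> \<le> (2 powr (2 * log 2 (real (order G)) + (log 2 (real (order G)))\<^sup>2)) * ?b"
  proof (rule mult_right_mono)
    have "card I \<le> card (carrier G \<times> carrier G \<times> endomorphisms_on N)"
      using I_sub by (intro card_mono) (use fin endo in simp)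
    then have "real (card I) \<le> real (order G) * real (order G) * real (card (endomorphisms_on N))"
      by (simp only: card_cartesian_product order_def of_nat_mult[symmetric] of_nat_le_iff mult.assoc)
    also have "\<dots> \<le> real (order G) * real (order G) * 2 powr (log 2 (real (order G)))\<^sup>2"
    proof (rule mult_left_mono)
      have "0 < card N" using N finN by (metis card_gt_0_iff empty_iff subgroup.one_closed)
      moreover have "card N \<le> order G" using NG fin by (simp add: order_def card_mono)
      ultimately have "(log 2 (real (card N)))\<^sup>2 \<le> (log 2 (real (order G)))\<^sup>2"
        by (intro power_mono) auto
      then show "real (card (endomorphisms_on N)) \<le> 2 powr (log 2 (real (order G)))\<^sup>2"
        using endo(2) by (smt (verit) powr_mono)
    qed simp
    also have "real (order G) * real (order G) = 2 powr (2 * log 2 (real (order G)))"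
    proof -
      have "0 < real (order G)" using fin by (simp add: order_gt_0_iff_finite)
      moreover have "2 * log 2 (real (order G)) = log 2 (real (order G)) + log 2 (real (order G))" by simp
      ultimately show ?thesis by (simp only: powr_add powr_log_cancel)
    qed
    also have "2 powr (2 * log 2 (real (order G))) * 2 powr (log 2 (real (order G)))\<^sup>2
        = 2 powr (2 * log 2 (real (order G)) + (log 2 (real (order G)))\<^sup>2)"
      by (simp add: powr_add)
    finally show "real (card I) \<le> 2 powr (2 * log 2 (real (order G)) + (log 2 (real (order G)))\<^sup>2)" .
  qed simp
  also have "\<dots> = 2 powr (c_value G - real (card N) / 80 + 2 * log 2 (real (order G))
                    + (log 2 (real (order G)))\<^sup>2)"
    by (simp add: powr_add[symmetric] algebra_simps)
  finally show ?thesis .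
qed

section \<open>Colour-preserving maps\<close>

text \<open>
  The structure of a generalised dicyclic group seen from inside: an abelian subgroup \<open>A\<close> of index
  \<open>2\<close> and exponent greater than \<open>2\<close>, and an element \<open>x\<close> outside \<open>A\<close> that inverts \<open>A\<close> and is not an
  involution. That \<open>x\<close> inverts \<open>a\<close> is written as \<open>a x a = x\<close>, which avoids inverses.
\<close>
definition dicyclic_decomposition :: "'a set \<Rightarrow> 'a \<Rightarrow> bool" where
  "dicyclic_decomposition A x \<longleftrightarrow>
     subgroup A G \<and> (\<forall>a\<in>A. \<forall>b\<in>A. a \<otimes> b = b \<otimes> a) \<and> (\<exists>a\<in>A. a \<otimes> a \<noteq> \<one>) \<and>
     x \<in> carrier G - A \<and> x \<otimes> x \<noteq> \<one> \<and> (\<forall>a\<in>A. a \<otimes> x \<otimes> a = x) \<and>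
     (\<forall>r\<in>carrier G - A. inv x \<otimes> r \<in> A)"

lemma inverts_iff:
  assumes "p \<in> carrier G" "q \<in> carrier G"
  shows "p \<otimes> q \<otimes> p = q \<longleftrightarrow> p \<otimes> q = q \<otimes> inv p"
    and "p \<otimes> q \<otimes> p = q \<longleftrightarrow> q \<otimes> p = inv p \<otimes> q"
  using assms by (auto simp: inv_solve_left inv_solve_right m_assoc)

lemma inverted_commute:
  assumes "p \<in> carrier G" "r \<in> carrier G" "q \<in> carrier G"
    and "p \<otimes> q \<otimes> p = q" "r \<otimes> q \<otimes> r = q" "(p \<otimes> r) \<otimes> q \<otimes> (p \<otimes> r) = q"
  shows "p \<otimes> r = r \<otimes> p"
proof -
  have "p \<otimes> r \<otimes> q \<otimes> (p \<otimes> r) = p \<otimes> (r \<otimes> q \<otimes> r) \<otimes> p" using assms by simp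
  also have "\<dots> = p \<otimes> r \<otimes> q \<otimes> (r \<otimes> p)" using assms(1-3) by (simp add: m_assoc)
  finally show ?thesis using assms(1-3) by simp
qed

lemma product_of_inverters_commutes:
  assumes "p \<in> carrier G" "q \<in> carrier G" "r \<in> carrier G"
    and "p \<otimes> q \<otimes> p = q" "p \<otimes> r \<otimes> p = r"
  shows "p \<otimes> (q \<otimes> r) = q \<otimes> r \<otimes> p"
proof -
  have "p \<otimes> (q \<otimes> r) = p \<otimes> q \<otimes> r" using assms by (simp add: m_assoc)
  also have "\<dots> = q \<otimes> (inv p \<otimes> r)" using assms inverts_iff(1)[of p q] by (simp add: m_assoc)
  also have "\<dots> = q \<otimes> r \<otimes> p" using assms inverts_iff(2)[of p r] by (simp add: m_assoc)
  finally show ?thesis .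
qed

text \<open>
  The case \<open>G = Q\<^sub>8 M\<close> with \<open>M\<close> the elementary abelian centraliser of \<open>Q\<^sub>8 = \<langle>i, j\<rangle>\<close>. The centraliser
  of \<open>j\<close> is \<open>\<langle>j\<rangle> M\<close>; it serves as \<open>A\<close>, and \<open>i\<close> as the element that inverts it.
\<close>
lemma quaternion_decomposition:
  assumes ij: "i \<in> carrier G" "j \<in> carrier G"
    and iji: "i \<otimes> j \<otimes> i = j" and jij: "j \<otimes> i \<otimes> j = i" and ii: "i \<otimes> i \<noteq> \<one>"
    and i: "\<And>r. r \<in> carrier G \<Longrightarrow> i \<otimes> r = r \<otimes> i \<or> i \<otimes> r \<otimes> i = r"
    and j: "\<And>r. r \<in> carrier G \<Longrightarrow> j \<otimes> r = r \<otimes> j \<or> j \<otimes> r \<otimes> j = r"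
    and elementary: "\<And>m. m \<in> carrier G \<Longrightarrow> i \<otimes> m = m \<otimes> i \<Longrightarrow> j \<otimes> m = m \<otimes> j \<Longrightarrow> m \<otimes> m = \<one>"
  shows "\<exists>A x. dicyclic_decomposition A x"
proof -
  define A where "A = {a \<in> carrier G. j \<otimes> a = a \<otimes> j}"
  have jj: "j \<otimes> j = i \<otimes> i"
  proof -
    have "j \<otimes> j \<otimes> i = j \<otimes> (i \<otimes> j \<otimes> i) \<otimes> i" by (simp only: iji)
    also have "\<dots> = (j \<otimes> i \<otimes> j) \<otimes> (i \<otimes> i)" using ij by (simp add: m_assoc)
    also have "\<dots> = i \<otimes> i \<otimes> i" using ij by (simp add: jij m_assoc)
    finally show ?thesis using ij by simp
  qed
  have A: "subgroup A G"
  proof (rule subgroupI)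
    show "A \<subseteq> carrier G" "A \<noteq> {}" using ij by (auto simp: A_def)
    show "a \<otimes> b \<in> A" if "a \<in> A" "b \<in> A" for a b
    proof -
      have c: "a \<in> carrier G" "b \<in> carrier G" "j \<otimes> a = a \<otimes> j" "j \<otimes> b = b \<otimes> j"
        using that by (auto simp: A_def)
      show ?thesis using commute_mult[OF ij(2) c] c by (simp add: A_def)
    qed
    show "inv a \<in> A" if "a \<in> A" for a
    proof -
      have c: "a \<in> carrier G" "j \<otimes> a = a \<otimes> j" using that by (auto simp: A_def)
      then have "j = a \<otimes> j \<otimes> inv a" using ij by (simp add: inv_solve_right)
      then have "inv a \<otimes> j = j \<otimes> inv a" using c ij by (simp add: inv_solve_left' m_assoc)
      then show ?thesis using c by (simp add: A_def)
    qed
  qed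
  have inverts: "a \<otimes> i \<otimes> a = i" if "a \<in> A" for a
  proof -
    have c: "a \<in> carrier G" "j \<otimes> a = a \<otimes> j" using that by (auto simp: A_def)
    show ?thesis using i[OF c(1)]
    proof
      assume com: "i \<otimes> a = a \<otimes> i"
      then have "a \<otimes> a = \<one>" using c by (intro elementary) auto
      then show ?thesis using c ij com by (metis m_assoc r_one)
    next
      assume inv: "i \<otimes> a \<otimes> i = a"
      have "i \<otimes> (j \<otimes> a) = j \<otimes> a \<otimes> i"
        using ij c iji inv by (intro product_of_inverters_commutes) auto
      moreover have "j \<otimes> (j \<otimes> a) = j \<otimes> a \<otimes> j" using ij(2) c by (intro commute_mult) auto
      ultimately have "(j \<otimes> a) \<otimes> (j \<otimes> a) = \<one>" using ij c by (intro elementary) auto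
      also have "(j \<otimes> a) \<otimes> (j \<otimes> a) = j \<otimes> (a \<otimes> j) \<otimes> a" using ij c(1) by (simp add: m_assoc)
      also have "\<dots> = j \<otimes> j \<otimes> (a \<otimes> a)" unfolding c(2)[symmetric] using ij c(1) by (simp add: m_assoc)
      finally have "i \<otimes> i \<otimes> (a \<otimes> a) = \<one>" by (simp add: jj)
      then have "i \<otimes> (i \<otimes> a \<otimes> a) = \<one>" using ij c(1) by (simp add: m_assoc)
      then have "i \<otimes> a \<otimes> a = inv i" using ij c(1) by (metis inv_equality inv_comm m_closed)
      then have 1: "i \<otimes> a \<otimes> a \<otimes> i = \<one>" using ij by simp
      have "a \<otimes> i \<otimes> a = (i \<otimes> a \<otimes> i) \<otimes> i \<otimes> a" by (simp only: inv)
      also have "\<dots> = i \<otimes> a \<otimes> (i \<otimes> i \<otimes> a)" using ij c(1) by (simp add: m_assoc)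
      also have "i \<otimes> i \<otimes> a = inv a"
      proof -
        have "i \<otimes> i \<otimes> a \<otimes> a = \<one>" using \<open>i \<otimes> i \<otimes> (a \<otimes> a) = \<one>\<close> ij c(1) by (simp add: m_assoc)
        then show ?thesis using ij c(1) by (metis inv_equality m_closed)
      qed
      also have "i \<otimes> a \<otimes> inv a = i" using ij c(1) by (simp add: m_assoc)
      finally show ?thesis .
    qed
  qed
  have AG: "\<And>a. a \<in> A \<Longrightarrow> a \<in> carrier G" by (simp add: A_def)
  have "\<forall>a\<in>A. \<forall>b\<in>A. a \<otimes> b = b \<otimes> a"
    using AG inverts ij A by (auto intro!: inverted_commute[where q = i] simp: subgroup.m_closed)
  moreover have "j \<in> A" using ij by (simp add: A_def)
  moreover have "i \<notin> A"
  proof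
    assume "i \<in> A"
    then have "j \<otimes> (i \<otimes> i) = i \<otimes> j \<otimes> i" using ij by (simp add: A_def m_assoc[symmetric])
    then show False using ij ii iji by simp
  qed
  moreover have "inv i \<otimes> r \<in> A" if r: "r \<in> carrier G" "r \<notin> A" for r
  proof -
    have "j \<otimes> r \<otimes> j = r" using j[OF r(1)] r by (auto simp: A_def)
    moreover have "j \<otimes> inv i \<otimes> j = inv i"
    proof -
      have "inv (j \<otimes> inv i \<otimes> j) = inv j \<otimes> (i \<otimes> inv j)" using ij by (simp add: inv_mult_group)
      also have "\<dots> = i" using inverts_iff(1)[of j i] jij ij by (simp add: inv_solve_left' m_assoc)
      finally show ?thesis using ij by (metis inv_inv inv_closed m_closed)
    qed
    ultimately have "j \<otimes> (inv i \<otimes> r) = inv i \<otimes> r \<otimes> j"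
      using ij r by (intro product_of_inverters_commutes) auto
    then show ?thesis using ij r by (simp add: A_def)
  qed
  moreover have "j \<otimes> j \<noteq> \<one>" using ii by (simp only: jj) simp
  ultimately have "dicyclic_decomposition A i"
    using A inverts ij(1) ii unfolding dicyclic_decomposition_def by blast
  then show ?thesis by blast
qed

text \<open>
  Let \<open>P\<close> be the set of fixed points of \<open>f\<close>; all other elements are sent to their inverses. Comparing
  the two possible values of \<open>f r\<close> for \<open>r = (r p\<^sup>-\<^sup>1) p\<close> shows that every \<open>r\<close> outside \<open>P\<close> inverts every
  \<open>p\<close> in \<open>P\<close>. If two elements of \<open>P\<close> have their product in \<open>P\<close>, they therefore commute; otherwise
  they invert each other and generate a quaternion group. So there are three cases: \<open>P\<close> contains
  such a quaternion pair; \<open>P\<close> is a subgroup of exponent greater than \<open>2\<close>, and then it has index \<open>2\<close>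
  and is inverted by \<open>q\<close>; or \<open>P\<close> consists of involutions and \<open>1\<close>, and then \<open>f\<close> is inversion on the
  whole group. In the last case any two elements commute or invert each other, and a pair that does
  not commute again generates a quaternion group.
\<close>
theorem colour_preserving_map:
  assumes fin: "finite (carrier G)"
    and f: "\<And>x y. x \<in> carrier G \<Longrightarrow> y \<in> carrier G \<Longrightarrow>
              f (x \<otimes> y) = x \<otimes> f y \<or> f (x \<otimes> y) = inv x \<otimes> f y"
    and f_one: "f \<one> = \<one>" and q: "q \<in> carrier G" "f q \<noteq> q"
  shows "comm_group G \<or> (\<exists>A x. dicyclic_decomposition A x)"
proof -
  have f_inv: "f x = x \<or> f x = inv x" if "x \<in> carrier G" for x
    using f[OF that one_closed] that by (simp add: f_one)
  define P where "P = {x \<in> carrier G. f x = x}"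
  have PG: "P \<subseteq> carrier G" by (auto simp: P_def)
  have not_P: "f x = inv x" "inv x \<noteq> x" if "x \<in> carrier G" "x \<notin> P" for x
    using that f_inv[OF that(1)] by (auto simp: P_def)
  have not_invol: "x \<otimes> x \<noteq> \<one>" if "x \<in> carrier G" "x \<notin> P" for x
    using not_P[OF that] that(1) by (metis inv_equality)
  have qP: "q \<notin> P" using q by (simp add: P_def)
  have oneP: "\<one> \<in> P" using f_one by (simp add: P_def)
  have inverts: "p \<otimes> r \<otimes> p = r" if p: "p \<in> P" and r: "r \<in> carrier G" "r \<notin> P" for p r
  proof -
    have pG: "p \<in> carrier G" "f p = p" using p by (auto simp: P_def)
    define x where "x = r \<otimes> inv p"
    have x: "x \<in> carrier G" "x \<otimes> p = r" using pG r by (auto simp: x_def m_assoc)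
    have "f r = x \<otimes> p \<or> f r = inv x \<otimes> p" using f[OF x(1) pG(1)] x(2) pG(2) by simp
    then have "inv r = inv x \<otimes> p" using not_P[OF r] x(2) by auto
    also have "inv x \<otimes> p = p \<otimes> inv r \<otimes> p" using pG r by (simp add: x_def inv_mult_group)
    finally have "inv (p \<otimes> inv r \<otimes> p) = r" using r by simp
    then have "inv p \<otimes> (r \<otimes> inv p) = r" using pG r by (simp add: inv_mult_group)
    then show ?thesis using pG r by (simp add: inv_solve_left' inv_solve_right' m_assoc)
  qed
  \<comment> \<open>Both \<open>p\<close>, \<open>p'\<close> and their product are inverted by \<open>q\<close>.\<close>
  have commute: "p \<otimes> p' = p' \<otimes> p" if "p \<in> P" "p' \<in> P" "p \<otimes> p' \<in> P" for p p'
    using that PG q qP inverts by (intro inverted_commute[where q = q]) auto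
  have quaternion: "p \<otimes> p' \<otimes> p = p'" "p' \<otimes> p \<otimes> p' = p"
    if p: "p \<in> P" "p' \<in> P" "p \<otimes> p' \<notin> P" for p p'
  proof -
    have c: "p \<in> carrier G" "p' \<in> carrier G" using p PG by auto
    have "p \<otimes> (p \<otimes> p') \<otimes> p = p \<otimes> p'" "p' \<otimes> (p \<otimes> p') \<otimes> p' = p \<otimes> p'"
      using inverts[of _ "p \<otimes> p'"] p c by auto
    then show "p \<otimes> p' \<otimes> p = p'" "p' \<otimes> p \<otimes> p' = p" using c by (simp_all add: m_assoc)
      (metis m_assoc m_closed r_cancel)
  qed
  show ?thesis
  proof (cases "\<forall>p\<in>P. \<forall>p'\<in>P. p \<otimes> p' \<in> P")
    case False
    then obtain i j where ij: "i \<in> P" "j \<in> P" "i \<otimes> j \<notin> P" by blast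
    have c: "i \<in> carrier G" "j \<in> carrier G" using ij PG by auto
    note Q = quaternion[OF ij]
    have either: "p \<otimes> r = r \<otimes> p \<or> p \<otimes> r \<otimes> p = r" if "p \<in> P" "r \<in> carrier G" for p r
      using that inverts commute quaternion(1) by metis
    have "i \<otimes> i \<noteq> \<one>"
    proof
      assume ii: "i \<otimes> i = \<one>"
      have "j \<otimes> i = (i \<otimes> j \<otimes> i) \<otimes> i" by (simp only: Q)
      also have "\<dots> = i \<otimes> j" using c ii by (simp add: m_assoc)
      finally have com: "j \<otimes> i = i \<otimes> j" .
      then have "i \<otimes> (j \<otimes> j) = i" using Q(2) c by (simp add: m_assoc)
      then have jj: "j \<otimes> j = \<one>" using c by simp
      have "(i \<otimes> j) \<otimes> (i \<otimes> j) = i \<otimes> (j \<otimes> i) \<otimes> j" using c by (simp add: m_assoc)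
      also have "\<dots> = (i \<otimes> i) \<otimes> (j \<otimes> j)" unfolding com using c by (simp add: m_assoc)
      finally show False using not_invol[of "i \<otimes> j"] ij c ii jj by simp
    qed
    moreover have "m \<otimes> m = \<one>" if m: "m \<in> carrier G" "i \<otimes> m = m \<otimes> i" "j \<otimes> m = m \<otimes> j" for m
    proof -
      have "m \<in> P"
      proof (rule ccontr)
        assume "m \<notin> P"
        then have "i \<otimes> m \<otimes> i = m" using inverts ij m by blast
        then have "m \<otimes> (i \<otimes> i) = m" using m c by (simp add: m_assoc)
        then show False using m c \<open>i \<otimes> i \<noteq> \<one>\<close> by simp
      qed
      then have "m \<otimes> (i \<otimes> j) \<otimes> m = i \<otimes> j" using inverts ij c by blast
      moreover have "m \<otimes> (i \<otimes> j) \<otimes> m = (i \<otimes> j) \<otimes> (m \<otimes> m)"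
      proof -
        have "m \<otimes> (i \<otimes> j) = (i \<otimes> m) \<otimes> j" using m c by (simp add: m_assoc[symmetric])
        also have "\<dots> = i \<otimes> (j \<otimes> m)" unfolding m(3) using m(1) c by (simp add: m_assoc)
        finally show ?thesis using m(1) c by (simp add: m_assoc)
      qed
      ultimately show ?thesis using m c by simp
    qed
    ultimately have "\<exists>A x. dicyclic_decomposition A x"
      using quaternion_decomposition[OF c Q _ either[OF ij(1)] either[OF ij(2)]] by blast
    then show ?thesis ..
  next
    case closed: True
    show ?thesis
    proof (cases "\<forall>p\<in>P. p \<otimes> p = \<one>")
      case False
      then obtain p where p: "p \<in> P" "p \<otimes> p \<noteq> \<one>" by blast
      have pG: "p \<in> carrier G" using p PG by blast
      have sub: "subgroup P G"
      proof (rule subgroupI)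
        show "inv a \<in> P" if a: "a \<in> P" for a
        proof (rule ccontr)
          assume n: "inv a \<notin> P"
          have aG: "a \<in> carrier G" using a PG by blast
          have "a \<otimes> inv a \<otimes> a = inv a" by (rule inverts[OF a inv_closed[OF aG] n])
          moreover have "a \<otimes> inv a \<otimes> a = a" using aG by simp
          ultimately show False using n a by metis
        qed
      qed (use PG oneP closed in auto)
      have "inv q \<otimes> r \<in> P" if r: "r \<in> carrier G" "r \<notin> P" for r
      proof (rule ccontr)
        assume n: "inv q \<otimes> r \<notin> P"
        define s where "s = inv q \<otimes> r"
        have s: "s \<in> carrier G" "s \<notin> P" "r = q \<otimes> s" using r n q(1) by (auto simp: s_def m_assoc[symmetric])
        have "p \<otimes> (q \<otimes> s) = q \<otimes> s \<otimes> p"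
          using pG q(1) s inverts[OF p(1)] qP by (intro product_of_inverters_commutes) auto
        then have "r \<otimes> (p \<otimes> p) = p \<otimes> r \<otimes> p" using r pG q s by (simp add: m_assoc)
        also have "\<dots> = r" using inverts p r by blast
        finally show False using r pG p by simp
      qed
      moreover have "\<forall>a\<in>P. \<forall>b\<in>P. a \<otimes> b = b \<otimes> a" using closed commute by blast
      ultimately have "dicyclic_decomposition P q"
        using sub p q qP inverts not_invol unfolding dicyclic_decomposition_def by auto
      then show ?thesis by blast
    next
      case True
      have f_eq: "f x = inv x" if "x \<in> carrier G" for x
        using True f_inv[OF that] that by (auto simp: P_def) (metis inv_equality)
      have either: "x \<otimes> y = y \<otimes> x \<or> x \<otimes> y \<otimes> x = y" if xy: "x \<in> carrier G" "y \<in> carrier G" for x y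
      proof -
        have "inv (x \<otimes> y) = x \<otimes> inv y \<or> inv (x \<otimes> y) = inv x \<otimes> inv y"
          using f[OF xy] xy by (simp add: f_eq)
        then have "x \<otimes> y = inv (x \<otimes> inv y) \<or> x \<otimes> y = inv (inv x \<otimes> inv y)"
          using xy by (metis inv_inv m_closed)
        then have "x \<otimes> y = y \<otimes> inv x \<or> x \<otimes> y = y \<otimes> x" using xy by (simp add: inv_mult_group)
        then show ?thesis using inverts_iff(1)[OF xy] by blast
      qed
      show ?thesis
      proof (cases "\<forall>x\<in>carrier G. \<forall>y\<in>carrier G. x \<otimes> y = y \<otimes> x")
        case True
        then have "comm_group G" by (intro group_comm_groupI) auto
        then show ?thesis ..
      next
        case False
        then obtain i j where ij: "i \<in> carrier G" "j \<in> carrier G" "i \<otimes> j \<noteq> j \<otimes> i" by blast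
        have Q: "i \<otimes> j \<otimes> i = j" "j \<otimes> i \<otimes> j = i" using either ij by metis+
        have "i \<otimes> i \<noteq> \<one>"
        proof
          assume ii: "i \<otimes> i = \<one>"
          have "j \<otimes> i = (i \<otimes> j \<otimes> i) \<otimes> i" by (simp only: Q)
          also have "\<dots> = i \<otimes> j" using ij ii by (simp add: m_assoc)
          finally show False using ij by simp
        qed
        moreover have "m \<otimes> m = \<one>" if m: "m \<in> carrier G" "i \<otimes> m = m \<otimes> i" "j \<otimes> m = m \<otimes> j" for m
        proof -
          have "i \<otimes> m \<otimes> j = j \<otimes> (i \<otimes> m) \<or> i \<otimes> m \<otimes> j \<otimes> (i \<otimes> m) = j"
            using either[of "i \<otimes> m" j] ij m by simp
          moreover have "i \<otimes> m \<otimes> j = m \<otimes> (i \<otimes> j)" using m ij by (simp add: m_assoc)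
          moreover have "j \<otimes> (i \<otimes> m) = m \<otimes> (j \<otimes> i)"
            unfolding m(2) using m(1,3) ij by (simp add: m_assoc[symmetric])
          ultimately have "i \<otimes> m \<otimes> j \<otimes> (i \<otimes> m) = j" using m(1) ij by auto
          moreover have "i \<otimes> m \<otimes> j \<otimes> (i \<otimes> m) = j \<otimes> (m \<otimes> m)"
          proof -
            have "i \<otimes> m \<otimes> j \<otimes> (i \<otimes> m) = i \<otimes> (m \<otimes> j) \<otimes> (i \<otimes> m)" using m(1) ij by (simp add: m_assoc)
            also have "\<dots> = i \<otimes> j \<otimes> (m \<otimes> i) \<otimes> m" unfolding m(3)[symmetric] using m(1) ij by (simp add: m_assoc)
            also have "\<dots> = (i \<otimes> j \<otimes> i) \<otimes> (m \<otimes> m)" unfolding m(2)[symmetric] using m(1) ij by (simp add: m_assoc)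
            finally show ?thesis by (simp only: Q)
          qed
          ultimately show ?thesis using m ij by simp
        qed
        ultimately have "\<exists>A x. dicyclic_decomposition A x"
          using quaternion_decomposition[OF ij(1,2) Q _ either[OF ij(1)] either[OF ij(2)]] by blast
        then show ?thesis ..
      qed
    qed
  qed
qed

section \<open>Recognising generalised dicyclic groups\<close>

text \<open>
  The elements of the presented group are the fibres of \<open>h\<close>, so \<open>r \<mapsto> {w. h w = r}\<close> is an
  isomorphism.
\<close>
lemma presented_group_isoI:
  fixes h :: "'g word \<Rightarrow> 'a"
  assumes cong: "\<And>u v. (u, v) \<in> pres_cong gens rels \<longleftrightarrow>
                    u \<in> words gens \<and> v \<in> words gens \<and> h u = h v"
    and hom: "\<And>u v. u \<in> words gens \<Longrightarrow> v \<in> words gens \<Longrightarrow> h (u @ v) = h u \<otimes> h v"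
    and surj: "h ` words gens = carrier G"
  shows "G \<cong> presented_group gens rels"
proof -
  define fibre where "fibre r = {w \<in> words gens. h w = r}" for r
  have append: "u @ v \<in> words gens" if "u \<in> words gens" "v \<in> words gens" for u v
    using that by (auto simp: words_def)
  have class_eq: "pres_cong gens rels `` {u} = fibre (h u)" if "u \<in> words gens" for u
    using that by (auto simp: fibre_def cong)
  have nonempty: "fibre r \<noteq> {}" if "r \<in> carrier G" for r
    using that unfolding surj[symmetric] by (auto simp: fibre_def)
  have "(\<Union>u\<in>fibre r. \<Union>v\<in>fibre s. pres_cong gens rels `` {u @ v}) = fibre (r \<otimes> s)"
    if rs: "r \<in> carrier G" "s \<in> carrier G" for r s
  proof -
    have "pres_cong gens rels `` {u @ v} = fibre (r \<otimes> s)" if "u \<in> fibre r" "v \<in> fibre s" for u v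
      using that class_eq[of "u @ v"] append[of u v] hom[of u v] by (auto simp: fibre_def)
    then show ?thesis using nonempty[OF rs(1)] nonempty[OF rs(2)] by auto
  qed
  moreover have img: "fibre ` carrier G = words gens // pres_cong gens rels"
    using class_eq unfolding quotient_def surj[symmetric] by auto
  moreover have "inj_on fibre (carrier G)"
    using nonempty by (intro inj_onI) (auto simp: fibre_def)
  ultimately have "fibre \<in> iso G (presented_group gens rels)"
    by (auto simp: iso_def hom_def bij_betw_def presented_group_def)
  then show ?thesis by (rule is_isoI)
qed

lemma dicyclic_decompositionD:
  assumes "dicyclic_decomposition A x"
  shows "subgroup A G" "\<And>a. a \<in> A \<Longrightarrow> a \<in> carrier G" "x \<in> carrier G" "x \<notin> A" "x \<otimes> x \<noteq> \<one>"
    and "\<And>a b. a \<in> A \<Longrightarrow> b \<in> A \<Longrightarrow> a \<otimes> b = b \<otimes> a"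
    and "\<exists>a\<in>A. a \<otimes> a \<noteq> \<one>"
    and "\<And>a. a \<in> A \<Longrightarrow> a \<otimes> x = x \<otimes> inv a"
    and "\<And>r. r \<in> carrier G \<Longrightarrow> r \<notin> A \<Longrightarrow> inv x \<otimes> r \<in> A"
    and "x \<otimes> x \<in> A" "(x \<otimes> x) \<otimes> (x \<otimes> x) = \<one>"
proof -
  show A: "subgroup A G" and AG: "\<And>a. a \<in> A \<Longrightarrow> a \<in> carrier G"
    using assms by (auto simp: dicyclic_decomposition_def dest: subgroup.mem_carrier)
  show x: "x \<in> carrier G" "x \<notin> A" "x \<otimes> x \<noteq> \<one>" and ex: "\<exists>a\<in>A. a \<otimes> a \<noteq> \<one>"
    and com: "\<And>a b. a \<in> A \<Longrightarrow> b \<in> A \<Longrightarrow> a \<otimes> b = b \<otimes> a"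
    and coset: "\<And>r. r \<in> carrier G \<Longrightarrow> r \<notin> A \<Longrightarrow> inv x \<otimes> r \<in> A"
    using assms by (auto simp: dicyclic_decomposition_def)
  show inverts: "a \<otimes> x = x \<otimes> inv a" if "a \<in> A" for a
    using assms that AG x inverts_iff(1)[of a x] by (auto simp: dicyclic_decomposition_def)
  show xx: "x \<otimes> x \<in> A"
  proof (rule ccontr)
    assume "x \<otimes> x \<notin> A"
    then have "inv x \<otimes> (x \<otimes> x) \<in> A" using coset x by blast
    then show False using x by (simp add: m_assoc[symmetric])
  qed
  have "x \<otimes> (x \<otimes> x) = x \<otimes> inv (x \<otimes> x)" using inverts[OF xx] x by (simp add: m_assoc)
  then have "x \<otimes> x = inv (x \<otimes> x)" using x by simp
  then show "(x \<otimes> x) \<otimes> (x \<otimes> x) = \<one>" using x by (metis m_closed r_inv)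
qed

text \<open>
  The map \<open>h\<close> evaluates a word in the group. The relations hold in the group, so congruent words have
  the same value. Conversely, the relations rewrite every word to a normal form \<open>a\<close> or \<open>x a\<close> with
  \<open>a \<in> A\<close>, and this normal form can be read off from the value.
\<close>
lemma dicyclic_decomposition_pres_cong:
  fixes A :: "'a set" and x :: 'a
  defines "H \<equiv> \<lparr>carrier = A, monoid.mult = (\<otimes>), one = \<one>\<rparr>"
  defines "val \<equiv> \<lambda>(b, g). let r = (case g of None \<Rightarrow> x | Some a \<Rightarrow> a) in if b then r else inv r"
  defines "h \<equiv> \<lambda>w. foldr (\<lambda>l. (\<otimes>) (val l)) w \<one>"
  assumes D: "dicyclic_decomposition A x"
  shows "\<And>u v. u \<in> words (dic_generators H) \<Longrightarrow> v \<in> words (dic_generators H) \<Longrightarrow>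
           h (u @ v) = h u \<otimes> h v"
    and "h ` words (dic_generators H) = carrier G"
    and "\<And>u v. (u, v) \<in> pres_cong (dic_generators H) (dic_relations H (x \<otimes> x)) \<longleftrightarrow>
           u \<in> words (dic_generators H) \<and> v \<in> words (dic_generators H) \<and> h u = h v"
proof -
  note A = dicyclic_decompositionD[OF D]
  note closed = subgroup.m_closed[OF A(1)] subgroup.m_inv_closed[OF A(1)] subgroup.one_closed[OF A(1)]
  define gens where "gens = dic_generators H"
  define rels where "rels = dic_relations H (x \<otimes> x)"
  have gens_iff: "g \<in> gens \<longleftrightarrow> (case g of None \<Rightarrow> True | Some a \<Rightarrow> a \<in> A)" for g
    by (auto simp: gens_def dic_generators_def H_def split: option.split)
  have words_simps: "[] \<in> words gens"
    "(b, g) # w \<in> words gens \<longleftrightarrow> g \<in> gens \<and> w \<in> words gens"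
    "u @ v \<in> words gens \<longleftrightarrow> u \<in> words gens \<and> v \<in> words gens" for b g u v w
    by (auto simp: words_def)
  have h_simps: "h [] = \<one>" "h (l # w) = val l \<otimes> h w" for l w by (simp_all add: h_def)
  have val_closed: "val (b, g) \<in> carrier G" if "g \<in> gens" for b g
    using that A(2,3) by (auto simp: val_def gens_iff split: option.splits)
  have h_closed: "h w \<in> carrier G" if "w \<in> words gens" for w
    using that by (induction w) (auto simp: h_simps words_simps val_closed)
  show hom: "h (u @ v) = h u \<otimes> h v" if "u \<in> words (dic_generators H)" "v \<in> words (dic_generators H)" for u v
    using that unfolding gens_def[symmetric]
    by (induction u) (auto simp: h_simps words_simps val_closed h_closed m_assoc)
  note hom = hom[folded gens_def]

  have sound: "u \<in> words gens \<and> v \<in> words gens \<and> h u = h v" if "(u, v) \<in> pres_cong gens rels" for u v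
    using that
  proof (induction rule: pres_cong.induct)
    case (relation u v)
    then consider
      (mult) a b where "a \<in> A" "b \<in> A" "u = [(True, Some a), (True, Some b)]" "v = [(True, Some (a \<otimes> b))]"
      | (square) "u = [(True, None), (True, None)]" "v = [(True, Some (x \<otimes> x))]"
      | (conj) a where "a \<in> A" "u = [(False, None), (True, Some a), (True, None)]" "v = [(False, Some a)]"
      by (auto simp: rels_def dic_relations_def H_def)
    then show ?case
    proof cases
      case mult
      then show ?thesis using A closed by (auto simp: words_simps gens_iff h_simps val_def)
    next
      case square
      then show ?thesis using A closed by (auto simp: words_simps gens_iff h_simps val_def)
    next
      case conj
      have "inv x \<otimes> (a \<otimes> x) = inv a"
        unfolding A(8)[OF conj(1)] using A(2)[OF conj(1)] A(3) by (simp add: m_assoc[symmetric])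
      then show ?thesis using conj A closed by (auto simp: words_simps gens_iff h_simps val_def)
    qed
  next
    case (cancel g b)
    then show ?case using A(2,3)
      by (cases b) (auto simp: words_simps h_simps val_def gens_iff split: option.splits)
  next
    case (append u u' v v')
    then show ?case by (simp add: words_simps hom)
  qed auto

  define sim (infix "\<asymp>" 50) where "u \<asymp> v \<longleftrightarrow> (u, v) \<in> pres_cong gens rels" for u v
  have sim_trans [trans]: "u \<asymp> w" if "u \<asymp> v" "v \<asymp> w" for u v w
    using that unfolding sim_def by (rule pres_cong.trans)
  have sim_sym: "v \<asymp> u" if "u \<asymp> v" for u v using that unfolding sim_def by (rule pres_cong.sym)
  have sim_in: "u @ v @ w \<asymp> u @ v' @ w" if "v \<asymp> v'" "u \<in> words gens" "w \<in> words gens" for u v v' w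
    using that unfolding sim_def by (intro pres_cong.append pres_cong.refl)
  have sim_r: "u @ v \<asymp> u @ v'" if "v \<asymp> v'" "u \<in> words gens" for u v v'
    using sim_in[OF that, of "[]"] by (simp add: words_simps)
  have sim_l: "v @ w \<asymp> v' @ w" if "v \<asymp> v'" "w \<in> words gens" for v v' w
    using sim_in[OF that(1) _ that(2), of "[]"] by (simp add: words_simps)

  define T where "T a = [(True, Some a)]" for a :: 'a
  define T' where "T' a = [(False, Some a)]" for a :: 'a
  define U :: "'a option word" where "U = [(True, None)]"
  define U' :: "'a option word" where "U' = [(False, None)]"
  have W: "T a \<in> words gens" "T' a \<in> words gens" "U \<in> words gens" "U' \<in> words gens" if "a \<in> A" for a
    using that by (auto simp: T_def T'_def U_def U'_def words_simps gens_iff)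
  note U_words = W(3,4)[OF closed(3)]
  have TT: "T a @ T b \<asymp> T (a \<otimes> b)" if "a \<in> A" "b \<in> A" for a b
    using that unfolding sim_def
    by (intro pres_cong.relation) (auto simp: T_def rels_def dic_relations_def H_def)
  have UU: "U @ U \<asymp> T (x \<otimes> x)"
    unfolding sim_def by (intro pres_cong.relation) (auto simp: T_def U_def rels_def dic_relations_def)
  have conj: "U' @ T a @ U \<asymp> T' a" if "a \<in> A" for a
    using that unfolding sim_def
    by (intro pres_cong.relation) (auto simp: T_def T'_def U_def U'_def rels_def dic_relations_def H_def)
  have cancel: "T a @ T' a \<asymp> []" "T' a @ T a \<asymp> []" if "a \<in> A" for a
    using that pres_cong.cancel[of "Some a" gens True rels] pres_cong.cancel[of "Some a" gens False rels]
    by (simp_all add: sim_def T_def T'_def gens_iff)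
  have cancelU: "U @ U' \<asymp> []" "U' @ U \<asymp> []"
    using pres_cong.cancel[of None gens True rels] pres_cong.cancel[of None gens False rels]
    by (simp_all add: sim_def U_def U'_def gens_iff)
  have T_one: "T \<one> \<asymp> []"
  proof -
    have "T \<one> \<asymp> T \<one> @ T \<one> @ T' \<one>"
      using sim_r[OF sim_sym[OF cancel(1)] W(1)] closed(3) by simp
    also have "\<dots> \<asymp> T \<one> @ T' \<one>"
      using sim_l[OF TT[OF closed(3,3)] W(2)] closed(3) by simp
    also have "\<dots> \<asymp> []" using cancel(1) closed(3) by blast
    finally show ?thesis .
  qed
  have T'_eq: "T' a \<asymp> T (inv a)" if a: "a \<in> A" for a
  proof -
    have "T' a \<asymp> T' a @ T \<one>" using sim_r[OF sim_sym[OF T_one] W(2)[OF a]] by simp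
    also have "\<dots> \<asymp> T' a @ T a @ T (inv a)"
      using sim_r[OF sim_sym[OF TT[OF a closed(2)[OF a]]] W(2)[OF a]] A(2)[OF a] by simp
    also have "\<dots> \<asymp> T (inv a)" using sim_l[OF cancel(2)[OF a] W(1)[OF closed(2)[OF a]]] by simp
    finally show ?thesis .
  qed
  have TU: "T a @ U \<asymp> U @ T (inv a)" if a: "a \<in> A" for a
  proof -
    have "T a @ U \<asymp> U @ U' @ T a @ U"
      using sim_l[OF sim_sym[OF cancelU(1)], of "T a @ U"] W[OF a] by (simp add: words_simps)
    also have "\<dots> \<asymp> U @ T' a" using sim_r[OF conj[OF a] U_words(1)] by simp
    also have "\<dots> \<asymp> U @ T (inv a)" using sim_r[OF T'_eq[OF a] U_words(1)] .
    finally show ?thesis .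
  qed
  \<comment> \<open>Positive words suffice: \<open>x\<^sup>-\<^sup>1 = x\<^sup>3\<close>, as \<open>x\<^sup>4 = 1\<close>.\<close>
  have U'_eq: "U' \<asymp> U @ T (x \<otimes> x)"
  proof -
    have "[] \<asymp> T (x \<otimes> x) @ T (x \<otimes> x)"
      using sim_trans[OF TT[OF A(10,10)], of "[]"] T_one A(11) sim_sym by simp
    also have "\<dots> \<asymp> U @ U @ T (x \<otimes> x)"
      using sim_l[OF sim_sym[OF UU] W(1)[OF A(10)]] by simp
    finally have "U' \<asymp> U' @ U @ U @ T (x \<otimes> x)" using sim_r[OF _ U_words(2)] by force
    also have "\<dots> \<asymp> U @ T (x \<otimes> x)"
      using sim_l[OF cancelU(2), of "U @ T (x \<otimes> x)"] U_words(1) W(1)[OF A(10)] by (simp add: words_simps)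
    finally show ?thesis .
  qed

  define nf where "nf r = (if r \<in> A then T r else U @ T (inv x \<otimes> r))" for r
  have nf_words: "nf r \<in> words gens" if "r \<in> carrier G" for r
    using that W A(9) U_words by (simp add: nf_def words_simps)
  have mult_T: "T a @ nf r \<asymp> nf (a \<otimes> r)" if a: "a \<in> A" and r: "r \<in> carrier G" for a r
  proof (cases "r \<in> A")
    case True
    then show ?thesis using TT a closed by (simp add: nf_def)
  next
    case False
    define b where "b = inv x \<otimes> r"
    have b: "b \<in> A" using A(9) r False by (simp add: b_def)
    have aG: "a \<in> carrier G" "inv a \<in> A" using A(2) a closed(2) by auto
    have "a \<otimes> r \<notin> A"
    proof
      assume "a \<otimes> r \<in> A"
      then have "inv a \<otimes> (a \<otimes> r) \<in> A" using aG closed(1) by blast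
      then show False using False aG r by (simp add: m_assoc[symmetric])
    qed
    moreover have "inv x \<otimes> (a \<otimes> r) = inv a \<otimes> b"
    proof -
      have "inv x \<otimes> a \<otimes> x = inv a"
        using A(8)[OF a] aG A(3) by (simp add: m_assoc inv_solve_left')
      then have "inv x \<otimes> a = inv a \<otimes> inv x" using aG A(3) by (simp add: inv_solve_right)
      then show ?thesis using aG A(3) r by (simp add: b_def m_assoc[symmetric])
    qed
    ultimately have nf: "nf (a \<otimes> r) = U @ T (inv a \<otimes> b)" "nf r = U @ T b"
      using False by (simp_all add: nf_def b_def)
    have "T a @ U @ T b \<asymp> U @ T (inv a) @ T b" using sim_l[OF TU[OF a] W(1)[OF b]] by simp
    also have "\<dots> \<asymp> U @ T (inv a \<otimes> b)" using sim_r[OF TT[OF aG(2) b] U_words(1)] .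
    finally show ?thesis by (simp add: nf)
  qed
  have mult_U: "U @ nf r \<asymp> nf (x \<otimes> r)" if r: "r \<in> carrier G" for r
  proof (cases "r \<in> A")
    case True
    have "x \<otimes> r \<notin> A"
    proof
      assume "x \<otimes> r \<in> A"
      then have "x \<otimes> r \<otimes> inv r \<in> A" using True closed by blast
      then show False using A(3,4) r by (simp add: m_assoc)
    qed
    then have "nf (x \<otimes> r) = U @ nf r"
      using True A(3) r by (simp add: nf_def m_assoc[symmetric])
    then show ?thesis using pres_cong.refl nf_words[of "x \<otimes> r"] A(3) r by (simp add: sim_def)
  next
    case False
    define b where "b = inv x \<otimes> r"
    have b: "b \<in> A" using A(9) r False by (simp add: b_def)
    have e: "x \<otimes> x \<otimes> b = x \<otimes> r" using r A(3) by (simp add: b_def m_assoc) (simp add: m_assoc[symmetric])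
    then have "x \<otimes> r \<in> A" using closed(1)[OF A(10) b] by simp
    then have nf: "nf (x \<otimes> r) = T (x \<otimes> x \<otimes> b)" "nf r = U @ T b"
      using False by (simp_all add: nf_def b_def e[unfolded b_def])
    have "U @ U @ T b \<asymp> T (x \<otimes> x) @ T b" using sim_l[OF UU W(1)[OF b]] by simp
    also have "\<dots> \<asymp> T (x \<otimes> x \<otimes> b)" using TT[OF A(10) b] .
    finally show ?thesis by (simp add: nf)
  qed
  have normal_form: "w \<asymp> nf (h w)" if "w \<in> words gens" for w
    using that
  proof (induction w)
    case Nil
    then show ?case using sim_sym[OF T_one] closed(3) by (simp add: h_simps nf_def)
  next
    case (Cons l w)
    obtain b g where l: "l = (b, g)" by (cases l)
    have w: "g \<in> gens" "w \<in> words gens" "h w \<in> carrier G"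
      using Cons.prems h_closed by (auto simp: l words_simps)
    have IH: "[l] @ w \<asymp> [l] @ nf (h w)"
      using Cons.IH w by (intro sim_r) (auto simp: l words_simps)
    have nfw: "nf (h w) \<in> words gens" using nf_words w by blast
    have "[l] @ nf (h w) \<asymp> nf (val l \<otimes> h w)"
    proof (cases g)
      case None
      show ?thesis
      proof (cases b)
        case True
        then show ?thesis using mult_U[OF w(3)] None by (simp add: l U_def val_def)
      next
        case False
        have "x \<otimes> (x \<otimes> x \<otimes> h w) = inv x \<otimes> h w"
        proof -
          have "x \<otimes> (x \<otimes> (x \<otimes> x)) = \<one>" using A(11) A(3) by (simp add: m_assoc)
          then have "inv x = x \<otimes> (x \<otimes> x)" using A(3) by (metis inv_equality inv_comm m_closed)
          then show ?thesis using A(3) w(3) by (simp add: m_assoc)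
        qed
        moreover have "U' @ nf (h w) \<asymp> U @ T (x \<otimes> x) @ nf (h w)" using sim_l[OF U'_eq nfw] by simp
        then have "U' @ nf (h w) \<asymp> U @ nf (x \<otimes> x \<otimes> h w)"
          using sim_trans sim_r[OF mult_T[OF A(10) w(3)] U_words(1)] by blast
        then have "U' @ nf (h w) \<asymp> nf (x \<otimes> (x \<otimes> x \<otimes> h w))"
          using sim_trans mult_U[of "x \<otimes> x \<otimes> h w"] A(3) w(3) by blast
        ultimately show ?thesis using None False by (simp add: l U'_def val_def)
      qed
    next
      case (Some a)
      then have a: "a \<in> A" using w(1) by (simp add: gens_iff)
      show ?thesis
      proof (cases b)
        case True
        then show ?thesis using mult_T[OF a w(3)] Some by (simp add: l T_def val_def)
      next
        case False
        have "T' a @ nf (h w) \<asymp> nf (inv a \<otimes> h w)"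
          using sim_trans[OF sim_l[OF T'_eq[OF a] nfw] mult_T[OF closed(2)[OF a] w(3)]] .
        then show ?thesis using Some False by (simp add: l T'_def val_def)
      qed
    qed
    then show ?case using sim_trans[OF IH] by (simp add: h_simps)
  qed
  show "(u, v) \<in> pres_cong (dic_generators H) (dic_relations H (x \<otimes> x)) \<longleftrightarrow>
           u \<in> words (dic_generators H) \<and> v \<in> words (dic_generators H) \<and> h u = h v" for u v
    unfolding gens_def[symmetric] rels_def[symmetric]
  proof
    assume "u \<in> words gens \<and> v \<in> words gens \<and> h u = h v"
    then have "u \<asymp> nf (h v)" "nf (h v) \<asymp> v" using normal_form[of u] sim_sym[OF normal_form[of v]] by auto
    then have "u \<asymp> v" by (rule sim_trans)
    then show "(u, v) \<in> pres_cong gens rels" by (simp add: sim_def)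
  qed (rule sound)
  show "h ` words (dic_generators H) = carrier G"
    unfolding gens_def[symmetric]
  proof
    show "h ` words gens \<subseteq> carrier G" using h_closed by blast
    have "h (nf r) = r" if "r \<in> carrier G" for r
      using that A(2,3) by (simp add: nf_def T_def U_def h_simps val_def m_assoc[symmetric])
    then show "carrier G \<subseteq> h ` words gens" using nf_words by (metis image_iff subsetI)
  qed
qed

lemma group_exponent_gt_2:
  assumes "finite (carrier G)" and a: "a \<in> carrier G" "a \<otimes> a \<noteq> \<one>"
  shows "group_exponent G > 2"
proof -
  define good where "good n \<longleftrightarrow> n > 0 \<and> (\<forall>x\<in>carrier G. x [^] n = \<one>)" for n :: nat
  have "good (order G)"
    using assms(1) pow_order_eq_1 by (auto simp: good_def order_gt_0_iff_finite)
  then have "good (group_exponent G)"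
    unfolding group_exponent_def good_def[symmetric] by (rule LeastI)
  moreover have "\<not> good 1" "\<not> good 2"
    using a by (auto simp: good_def numeral_2_eq_2 intro!: bexI[of _ a])
  ultimately show ?thesis
    by (metis One_nat_def Suc_1 good_def less_2_cases linorder_neqE_nat not_less_zero)
qed

theorem dicyclic_decomposition_imp_generalised_dicyclic:
  assumes fin: "finite (carrier G)" and D: "dicyclic_decomposition A x"
  shows "generalised_dicyclic G"
proof -
  note A = dicyclic_decompositionD[OF D]
  define H where "H = \<lparr>carrier = A, monoid.mult = (\<otimes>), one = \<one>\<rparr>"
  have "group H"
  proof (rule groupI)
    show "\<exists>b\<in>carrier H. b \<otimes>\<^bsub>H\<^esub> a = \<one>\<^bsub>H\<^esub>" if "a \<in> carrier H" for a
      using that A(1,2) subgroup.m_inv_closed by (fastforce simp: H_def intro!: bexI[of _ "inv a"])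
  qed (use A(1,2) in \<open>auto simp: H_def m_assoc subgroup.m_closed subgroup.one_closed\<close>)
  then interpret H: group H .
  have comm: "comm_group H" using A(6) by (intro H.group_comm_groupI) (auto simp: H_def)
  have finH: "finite (carrier H)"
    using A(2) fin finite_subset[of A "carrier G"] by (auto simp: H_def)
  have exponent: "group_exponent H > 2"
    using A(7) H.group_exponent_gt_2[OF finH] by (auto simp: H_def)
  have xH: "x \<otimes> x \<in> carrier H" using A(10) by (simp add: H_def)
  have "(x \<otimes> x) [^]\<^bsub>H\<^esub> (2::nat) = \<one>\<^bsub>H\<^esub>"
    using A(11) xH by (simp add: numeral_2_eq_2) (simp add: H_def)
  then have "H.ord (x \<otimes> x) dvd 2" using H.pow_eq_id[OF xH] by simp
  moreover have "H.ord (x \<otimes> x) \<noteq> 1"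
    using H.ord_eq_1[OF xH] A(5) by (simp add: H_def)
  ultimately have ord: "H.ord (x \<otimes> x) = 2"
    using prime_nat_iff two_is_prime_nat by blast
  then have "even (order H)" using H.ord_dvd_group_order[OF xH] by simp
  moreover have "G \<cong> Dic H (x \<otimes> x)"
    unfolding Dic_def H_def
    by (rule presented_group_isoI[OF dicyclic_decomposition_pres_cong(3,1,2)[OF D]])
  ultimately show ?thesis
    unfolding generalised_dicyclic_def using comm finH exponent xH ord by blast
qed

section \<open>Automorphisms of Cayley graphs that normalise translations\<close>

text \<open>
  The automorphisms of the Cayley graph, described on ordered pairs of vertices instead of on the
  set of edges. The two descriptions agree for inverse-closed \<open>S\<close> (\<open>cayley_aut_eq\<close>).
\<close>
definition cayley_aut_set :: "'a set \<Rightarrow> ('a \<Rightarrow> 'a) set" where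
  "cayley_aut_set S =
     {f \<in> Bij (carrier G). \<forall>x\<in>carrier G. \<forall>y\<in>carrier G. y \<otimes> inv x \<in> S \<longleftrightarrow> f y \<otimes> inv (f x) \<in> S}"

lemma set_inv_closedD:
  assumes "S \<subseteq> carrier G" "S = set_inv S" "a \<in> carrier G"
  shows "inv a \<in> S \<longleftrightarrow> a \<in> S"
proof -
  have "inv b \<in> S" if "b \<in> S" for b using that assms(2) by (auto simp: SET_INV_def)
  then show ?thesis using assms(3) inv_inv by metis
qed

lemma cayley_aut_eq:
  assumes S: "S \<subseteq> carrier G" "S = set_inv S"
  shows "cayley_aut G S = BijGroup (carrier G)\<lparr>carrier := cayley_aut_set S\<rparr>"
proof -
  have edge_iff: "{r, t} \<in> cayley_edges G S \<longleftrightarrow> t \<otimes> inv r \<in> S"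
    if rt: "r \<in> carrier G" "t \<in> carrier G" for r t
  proof
    assume "{r, t} \<in> cayley_edges G S"
    then obtain r' t' where "{r, t} = {r', t'}" "t' \<otimes> inv r' \<in> S"
      by (auto simp: cayley_edges_def)
    then have "t \<otimes> inv r \<in> S \<or> r \<otimes> inv t \<in> S" by (auto simp: doubleton_eq_iff)
    moreover have "inv (t \<otimes> inv r) = r \<otimes> inv t" using rt by (simp add: inv_mult_group)
    ultimately show "t \<otimes> inv r \<in> S" using set_inv_closedD[OF S, of "t \<otimes> inv r"] rt by auto
  qed (use rt in \<open>auto simp: cayley_edges_def\<close>)
  have "(`) f ` cayley_edges G S = cayley_edges G S \<longleftrightarrow>
      (\<forall>x\<in>carrier G. \<forall>y\<in>carrier G. y \<otimes> inv x \<in> S \<longleftrightarrow> f y \<otimes> inv (f x) \<in> S)"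
    if f: "f \<in> Bij (carrier G)" for f
  proof -
    have bij: "inj_on f (carrier G)" "f ` carrier G = carrier G"
      using f by (auto simp: Bij_def bij_betw_def)
    have fG: "f x \<in> carrier G" if "x \<in> carrier G" for x using that bij(2) by blast
    show ?thesis
    proof
      assume img: "(`) f ` cayley_edges G S = cayley_edges G S"
      have "y \<otimes> inv x \<in> S \<longleftrightarrow> f y \<otimes> inv (f x) \<in> S" if xy: "x \<in> carrier G" "y \<in> carrier G" for x y
      proof -
      have "{x, y} \<in> cayley_edges G S \<longleftrightarrow> f ` {x, y} \<in> (`) f ` cayley_edges G S"
      proof
        assume "f ` {x, y} \<in> (`) f ` cayley_edges G S"
        then obtain e where e: "e \<in> cayley_edges G S" "f ` {x, y} = f ` e" by blast
        moreover have "e \<subseteq> carrier G" using e(1) by (auto simp: cayley_edges_def)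
        ultimately have "{x, y} = e"
          using inj_on_image_eq_iff[OF bij(1), of "{x, y}" e] xy by auto
        then show "{x, y} \<in> cayley_edges G S" using e(1) by simp
      qed blast
      then show ?thesis
        unfolding img using edge_iff[OF xy] edge_iff[OF fG[OF xy(1)] fG[OF xy(2)]] by simp
      qed
      then show "\<forall>x\<in>carrier G. \<forall>y\<in>carrier G. y \<otimes> inv x \<in> S \<longleftrightarrow> f y \<otimes> inv (f x) \<in> S" by blast
    next
      assume pres: "\<forall>x\<in>carrier G. \<forall>y\<in>carrier G. y \<otimes> inv x \<in> S \<longleftrightarrow> f y \<otimes> inv (f x) \<in> S"
      have pair: "{x, y} \<in> cayley_edges G S \<longleftrightarrow> {f x, f y} \<in> cayley_edges G S"
        if "x \<in> carrier G" "y \<in> carrier G" for x y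
        using that pres edge_iff[OF that] edge_iff[OF fG[OF that(1)] fG[OF that(2)]] by blast
      show "(`) f ` cayley_edges G S = cayley_edges G S"
      proof
        show "(`) f ` cayley_edges G S \<subseteq> cayley_edges G S"
        proof
          fix e' assume "e' \<in> (`) f ` cayley_edges G S"
          then obtain e where e: "e \<in> cayley_edges G S" "e' = f ` e" by blast
          then obtain x y where "x \<in> carrier G" "y \<in> carrier G" "e = {x, y}"
            by (auto simp: cayley_edges_def)
          then show "e' \<in> cayley_edges G S" using e pair by simp
        qed
        show "cayley_edges G S \<subseteq> (`) f ` cayley_edges G S"
        proof
          fix e assume e: "e \<in> cayley_edges G S"
          then obtain r t where "r \<in> carrier G" "t \<in> carrier G" "e = {r, t}"
            by (auto simp: cayley_edges_def)
          then obtain x y where "x \<in> carrier G" "y \<in> carrier G" "e = {f x, f y}"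
            using bij(2) by (metis imageE)
          then show "e \<in> (`) f ` cayley_edges G S"
            using e pair by (intro image_eqI[of _ _ "{x, y}"]) auto
        qed
      qed
    qed
  qed
  then show ?thesis by (simp add: cayley_aut_def cayley_aut_set_def cong: conj_cong)
qed

lemma subgroup_cayley_aut_set: "subgroup (cayley_aut_set S) (BijGroup (carrier G))"
proof -
  interpret B: group "BijGroup (carrier G)" by (rule group_BijGroup)
  show ?thesis
  proof (rule B.subgroupI)
    show "cayley_aut_set S \<subseteq> carrier (BijGroup (carrier G))"
      by (auto simp: cayley_aut_set_def BijGroup_def)
    have "(\<lambda>x\<in>carrier G. x) \<in> cayley_aut_set S"
      by (simp add: cayley_aut_set_def id_Bij)
    then show "cayley_aut_set S \<noteq> {}" by blast
    show "inv\<^bsub>BijGroup (carrier G)\<^esub> f \<in> cayley_aut_set S" if f: "f \<in> cayley_aut_set S" for f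
    proof -
      have fB: "f \<in> Bij (carrier G)" using f by (simp add: cayley_aut_set_def)
      then have bij: "inj_on f (carrier G)" "f ` carrier G = carrier G"
        by (auto simp: Bij_def bij_betw_def)
      define g where "g = (\<lambda>x\<in>carrier G. inv_into (carrier G) f x)"
      have g: "g x \<in> carrier G" "f (g x) = x" if "x \<in> carrier G" for x
        using that bij(2) inv_into_into[of x f "carrier G"] f_inv_into_f[of x f "carrier G"]
        by (auto simp: g_def)
      have "y \<otimes> inv x \<in> S \<longleftrightarrow> g y \<otimes> inv (g x) \<in> S" if "x \<in> carrier G" "y \<in> carrier G" for x y
        using f that g[OF that(1)] g[OF that(2)] by (fastforce simp: cayley_aut_set_def)
      then show ?thesis
        using restrict_inv_into_Bij[OF fB] by (simp add: inv_BijGroup[OF fB] cayley_aut_set_def g_def)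
    qed
    show "f \<otimes>\<^bsub>BijGroup (carrier G)\<^esub> g \<in> cayley_aut_set S"
      if "f \<in> cayley_aut_set S" "g \<in> cayley_aut_set S" for f g
    proof -
      have "f \<in> Bij (carrier G)" "g \<in> Bij (carrier G)" using that by (auto simp: cayley_aut_set_def)
      moreover have "g x \<in> carrier G" if "x \<in> carrier G" for x
        using that \<open>g \<in> Bij (carrier G)\<close> Bij_imp_funcset by blast
      ultimately show ?thesis
        using that by (auto simp: cayley_aut_set_def BijGroup_def compose_Bij compose_eq)
    qed
  qed
qed

lemma cayley_aut_facts:
  assumes S: "S \<subseteq> carrier G" "S = set_inv S"
  shows "group (cayley_aut G S)" "carrier (cayley_aut G S) = cayley_aut_set S"
    and "\<And>f g. f \<in> cayley_aut_set S \<Longrightarrow> g \<in> cayley_aut_set S \<Longrightarrow>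
           f \<otimes>\<^bsub>cayley_aut G S\<^esub> g = compose (carrier G) f g"
    and "\<one>\<^bsub>cayley_aut G S\<^esub> = (\<lambda>x\<in>carrier G. x)"
proof -
  show "group (cayley_aut G S)"
    unfolding cayley_aut_eq[OF S]
    by (rule subgroup.subgroup_is_group[OF subgroup_cayley_aut_set group_BijGroup])
qed (auto simp: cayley_aut_eq[OF S] BijGroup_def cayley_aut_set_def)

lemma translation_in_cayley_aut_set:
  assumes a: "a \<in> carrier G"
  shows "(\<lambda>r\<in>carrier G. r \<otimes> a) \<in> cayley_aut_set S"
proof -
  have "bij_betw (\<lambda>r\<in>carrier G. r \<otimes> a) (carrier G) (carrier G)"
    by (rule bij_betw_byWitness[of _ "\<lambda>r. r \<otimes> inv a"]) (use a in \<open>auto simp: m_assoc\<close>)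
  moreover have "y \<otimes> a \<otimes> inv (x \<otimes> a) = y \<otimes> inv x" if "x \<in> carrier G" "y \<in> carrier G" for x y
  proof -
    have "y \<otimes> a \<otimes> inv (x \<otimes> a) = y \<otimes> (a \<otimes> inv a) \<otimes> inv x"
      using that a by (simp only: inv_mult_group m_assoc m_closed inv_closed)
    then show ?thesis using that a by simp
  qed
  ultimately show ?thesis by (simp add: cayley_aut_set_def Bij_def)
qed

lemma right_regular_subset: "N \<subseteq> carrier G \<Longrightarrow> right_regular G N \<subseteq> cayley_aut_set S"
  using translation_in_cayley_aut_set by (auto simp: right_regular_def)

lemma normalizer_right_regularD:
  assumes S: "S \<subseteq> carrier G" "S = set_inv S" and N: "N \<subseteq> carrier G"
    and f: "f \<in> normalizer (cayley_aut G S) (right_regular G N)"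
  shows "f \<in> cayley_aut_set S"
    and "\<And>n. n \<in> N \<Longrightarrow> \<exists>m\<in>N. \<forall>r\<in>carrier G. f (r \<otimes> n) = f r \<otimes> m"
proof -
  note K = cayley_aut_facts[OF S]
  interpret K: group "cayley_aut G S" by (rule K(1))
  note sub = right_regular_subset[OF N, of S]
  show fK: "f \<in> cayley_aut_set S"
    using f by (simp add: normalizer_def stabilizer_def K(2))
  then have fG: "f r \<in> carrier G" if "r \<in> carrier G" for r
    using that Bij_imp_funcset by (auto simp: cayley_aut_set_def)
  have img: "(f <#\<^bsub>cayley_aut G S\<^esub> right_regular G N) #>\<^bsub>cayley_aut G S\<^esub> inv\<^bsub>cayley_aut G S\<^esub> f
      = right_regular G N"
    using f sub by (simp add: normalizer_def stabilizer_def K(2))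
  show "\<exists>m\<in>N. \<forall>r\<in>carrier G. f (r \<otimes> n) = f r \<otimes> m" if n: "n \<in> N" for n
  proof -
    define \<rho> where "\<rho> a = (\<lambda>r\<in>carrier G. r \<otimes> a)" for a
    have \<rho>K: "\<rho> a \<in> cayley_aut_set S" if "a \<in> N" for a
      using that N translation_in_cayley_aut_set by (auto simp: \<rho>_def)
    have "f \<otimes>\<^bsub>cayley_aut G S\<^esub> \<rho> n \<otimes>\<^bsub>cayley_aut G S\<^esub> inv\<^bsub>cayley_aut G S\<^esub> f \<in> right_regular G N"
      using n by (subst img[symmetric]) (auto simp: l_coset_def r_coset_def right_regular_def \<rho>_def)
    then obtain m where m: "m \<in> N"
      "f \<otimes>\<^bsub>cayley_aut G S\<^esub> \<rho> n \<otimes>\<^bsub>cayley_aut G S\<^esub> inv\<^bsub>cayley_aut G S\<^esub> f = \<rho> m"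
      by (auto simp: right_regular_def \<rho>_def)
    then have "f \<otimes>\<^bsub>cayley_aut G S\<^esub> \<rho> n = \<rho> m \<otimes>\<^bsub>cayley_aut G S\<^esub> f"
      using fK \<rho>K n m(1) K.inv_solve_right'[unfolded K(2), OF _ _ fK] K.m_closed[unfolded K(2)] by blast
    then have eq: "compose (carrier G) f (\<rho> n) = compose (carrier G) (\<rho> m) f"
      using fK \<rho>K n m K(3) by simp
    have "f (r \<otimes> n) = f r \<otimes> m" if r: "r \<in> carrier G" for r
      using fun_cong[OF eq, of r] r fG[OF r] by (simp add: compose_eq \<rho>_def)
    then show ?thesis using m by blast
  qed
qed

lemma automorphism_in_normalizer:
  assumes S: "S \<subseteq> carrier G" "S = set_inv S"
    and f: "f \<in> cayley_aut_set S"
    and hom: "\<And>a b. a \<in> carrier G \<Longrightarrow> b \<in> carrier G \<Longrightarrow> f (a \<otimes> b) = f a \<otimes> f b"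
  shows "f \<in> normalizer (cayley_aut G S) (right_regular G (carrier G))"
proof -
  note K = cayley_aut_facts[OF S]
  interpret K: group "cayley_aut G S" by (rule K(1))
  note sub = right_regular_subset[OF subset_refl, of S]
  define \<rho> where "\<rho> a = (\<lambda>r\<in>carrier G. r \<otimes> a)" for a
  have regular: "right_regular G (carrier G) = \<rho> ` carrier G"
    by (auto simp: right_regular_def \<rho>_def)
  have \<rho>K: "\<rho> a \<in> cayley_aut_set S" if "a \<in> carrier G" for a
    using that translation_in_cayley_aut_set by (auto simp: \<rho>_def)
  have onto: "f ` carrier G = carrier G"
    using f by (auto simp: cayley_aut_set_def Bij_def bij_betw_def)
  have conj: "f \<otimes>\<^bsub>cayley_aut G S\<^esub> \<rho> a \<otimes>\<^bsub>cayley_aut G S\<^esub> inv\<^bsub>cayley_aut G S\<^esub> f = \<rho> (f a)"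
    if a: "a \<in> carrier G" for a
  proof -
    have fa: "f a \<in> carrier G" using a onto by blast
    have "compose (carrier G) f (\<rho> a) = compose (carrier G) (\<rho> (f a)) f"
      using a onto hom by (auto simp: compose_def \<rho>_def fun_eq_iff)
    then have "f \<otimes>\<^bsub>cayley_aut G S\<^esub> \<rho> a = \<rho> (f a) \<otimes>\<^bsub>cayley_aut G S\<^esub> f"
      using K(3) f \<rho>K a fa by simp
    then show ?thesis using f \<rho>K[OF a] \<rho>K[OF fa] K.inv_solve_right'[unfolded K(2), OF _ _ f] K.m_closed[unfolded K(2)] by blast
  qed
  have "(f <#\<^bsub>cayley_aut G S\<^esub> right_regular G (carrier G)) #>\<^bsub>cayley_aut G S\<^esub> inv\<^bsub>cayley_aut G S\<^esub> f
      = (\<lambda>a. \<rho> (f a)) ` carrier G"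
    unfolding regular using conj by (auto simp: l_coset_def r_coset_def)
  also have "\<dots> = right_regular G (carrier G)"
    unfolding regular using onto by (metis image_image)
  finally show ?thesis
    using f sub by (simp add: normalizer_def stabilizer_def K(2))
qed

text \<open>
  Such an \<open>\<alpha>\<close> is an automorphism of every undirected Cayley graph and normalises the group of right
  translations, but a right translation that fixes \<open>1\<close> is the identity.
\<close>
lemma inverting_automorphism_not_self_normalizing:
  assumes S: "S \<subseteq> carrier G" "S = set_inv S"
    and \<alpha>: "\<And>a b. a \<in> carrier G \<Longrightarrow> b \<in> carrier G \<Longrightarrow> \<alpha> (a \<otimes> b) = \<alpha> a \<otimes> \<alpha> b"
      "\<And>a. a \<in> carrier G \<Longrightarrow> \<alpha> (\<alpha> a) = a"
      "\<And>a. a \<in> carrier G \<Longrightarrow> \<alpha> a = a \<or> \<alpha> a = inv a"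
    and q: "q \<in> carrier G" "\<alpha> q \<noteq> q"
  shows "right_regular G (carrier G) \<noteq> normalizer (cayley_aut G S) (right_regular G (carrier G))"
proof
  assume eq: "right_regular G (carrier G) = normalizer (cayley_aut G S) (right_regular G (carrier G))"
  define f where "f = restrict \<alpha> (carrier G)"
  have \<alpha>G: "\<alpha> a \<in> carrier G" if "a \<in> carrier G" for a using \<alpha>(3)[OF that] that by auto
  have "bij_betw f (carrier G) (carrier G)"
    by (rule bij_betw_byWitness[of _ \<alpha>]) (auto simp: f_def \<alpha>(2) \<alpha>G)
  moreover have "y \<otimes> inv x \<in> S \<longleftrightarrow> f y \<otimes> inv (f x) \<in> S" if xy: "x \<in> carrier G" "y \<in> carrier G" for x y
  proof -
    define z where "z = y \<otimes> inv x"
    have z: "z \<in> carrier G" "z \<otimes> x = y" using xy by (auto simp: z_def m_assoc)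
    then have "\<alpha> y = \<alpha> z \<otimes> \<alpha> x" using \<alpha>(1)[of z x] xy by simp
    then have "f y \<otimes> inv (f x) = \<alpha> z" using xy z \<alpha>G by (simp add: f_def m_assoc)
    moreover have "\<alpha> z \<in> S \<longleftrightarrow> z \<in> S" using \<alpha>(3)[OF z(1)] set_inv_closedD[OF S z(1)] by auto
    ultimately show ?thesis by (simp add: z_def)
  qed
  ultimately have "f \<in> cayley_aut_set S" by (simp add: cayley_aut_set_def Bij_def f_def)
  then have "f \<in> normalizer (cayley_aut G S) (right_regular G (carrier G))"
    by (rule automorphism_in_normalizer[OF S]) (simp add: f_def \<alpha>(1))
  then have "f \<in> right_regular G (carrier G)" using eq by blast
  then obtain c where c: "c \<in> carrier G" "f = (\<lambda>r\<in>carrier G. r \<otimes> c)"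
    by (auto simp: right_regular_def)
  have "\<alpha> \<one> = \<one>" using \<alpha>(3)[of \<one>] by simp
  then have "f \<one> = \<one>" by (simp add: f_def)
  then have "c = \<one>" using c(1) by (simp add: c(2))
  then have "f q = q" using q(1) by (simp add: c(2))
  then show False using q by (simp add: f_def)
qed

lemma comm_group_not_self_normalizing:
  assumes S: "S \<subseteq> carrier G" "S = set_inv S" and "comm_group G"
    and q: "q \<in> carrier G" "q \<otimes> q \<noteq> \<one>"
  shows "right_regular G (carrier G) \<noteq> normalizer (cayley_aut G S) (right_regular G (carrier G))"
proof (rule inverting_automorphism_not_self_normalizing[OF S, where \<alpha> = "m_inv G" and q = q])
  interpret comm_group G by fact
  show "inv (a \<otimes> b) = inv a \<otimes> inv b" if "a \<in> carrier G" "b \<in> carrier G" for a b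
    using that by (rule inv_mult)
  show "inv q \<noteq> q" using q by (metis r_inv)
qed (use q in auto)

text \<open>
  The automorphism is the identity on \<open>A\<close> and multiplication by the central involution \<open>y = x\<^sup>2\<close> outside
  \<open>A\<close>. It inverts the elements outside \<open>A\<close> since each of them has square \<open>y\<close>.
\<close>
lemma dicyclic_not_self_normalizing:
  assumes S: "S \<subseteq> carrier G" "S = set_inv S" and D: "dicyclic_decomposition A x"
  shows "right_regular G (carrier G) \<noteq> normalizer (cayley_aut G S) (right_regular G (carrier G))"
proof -
  note A = dicyclic_decompositionD[OF D]
  note closed = subgroup.m_closed[OF A(1)] subgroup.m_inv_closed[OF A(1)]
  define y where "y = x \<otimes> x"
  have y: "y \<in> A" "y \<in> carrier G" "y \<otimes> y = \<one>" "y \<noteq> \<one>" using A(3,5,10,11) by (auto simp: y_def)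
  define \<alpha> where "\<alpha> r = (if r \<in> A then r else r \<otimes> y)" for r
  have outside: "\<exists>b\<in>A. r = x \<otimes> b" if "r \<in> carrier G" "r \<notin> A" for r
    using that A(3,9) by (intro bexI[of _ "inv x \<otimes> r"]) (auto simp: m_assoc[symmetric])
  have both_outside: "r \<otimes> s \<in> A" and square: "r \<otimes> r = y"
    if rs: "r \<in> carrier G" "r \<notin> A" "s \<in> carrier G" "s \<notin> A" for r s
  proof -
    obtain b c where bc: "b \<in> A" "r = x \<otimes> b" "c \<in> A" "s = x \<otimes> c" using outside rs by metis
    have product: "(x \<otimes> b) \<otimes> (x \<otimes> c) = y \<otimes> (inv b \<otimes> c)" if "b \<in> A" "c \<in> A" for b c
    proof -
      have "(x \<otimes> b) \<otimes> (x \<otimes> c) = x \<otimes> (b \<otimes> x) \<otimes> c" using that A(2,3) by (simp add: m_assoc)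
      also have "\<dots> = y \<otimes> (inv b \<otimes> c)" unfolding A(8)[OF that(1)] using that A(2,3) by (simp add: m_assoc y_def)
      finally show ?thesis .
    qed
    show "r \<otimes> s \<in> A" using product[OF bc(1,3)] bc closed y by simp
    show "r \<otimes> r = y" using product[OF bc(1,1)] bc A(2) y by simp
  qed
  have mixed: "r \<otimes> s \<notin> A" "s \<otimes> r \<notin> A" if "r \<in> A" "s \<in> carrier G" "s \<notin> A" for r s
  proof -
    have rG: "r \<in> carrier G" "inv r \<in> A" using that A(2) closed by auto
    have "inv r \<otimes> (r \<otimes> s) = s" "s \<otimes> r \<otimes> inv r = s" using rG that by (auto simp: m_assoc[symmetric]) (simp add: m_assoc)
    then show "r \<otimes> s \<notin> A" "s \<otimes> r \<notin> A" using closed(1) rG that by metis+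
  qed
  have central: "y \<otimes> r = r \<otimes> y" if r: "r \<in> carrier G" for r
  proof (cases "r \<in> A")
    case True
    then show ?thesis using A(6) y by blast
  next
    case False
    then show ?thesis using square[OF r False r False] r by (metis m_assoc)
  qed
  show ?thesis
  proof (rule inverting_automorphism_not_self_normalizing[OF S, where \<alpha> = \<alpha> and q = x])
    show "\<alpha> (a \<otimes> b) = \<alpha> a \<otimes> \<alpha> b" if ab: "a \<in> carrier G" "b \<in> carrier G" for a b
    proof (cases "a \<in> A"; cases "b \<in> A")
      assume "a \<in> A" "b \<in> A"
      then show ?thesis using closed by (simp add: \<alpha>_def)
    next
      assume "a \<in> A" "b \<notin> A"
      then show ?thesis using mixed(1)[of a b] ab y by (simp add: \<alpha>_def m_assoc)
    next
      assume "a \<notin> A" "b \<in> A"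
      then show ?thesis using mixed(2)[of b a] ab y central[OF ab(2)] by (simp add: \<alpha>_def m_assoc)
    next
      assume n: "a \<notin> A" "b \<notin> A"
      have "a \<otimes> y \<otimes> (b \<otimes> y) = a \<otimes> (y \<otimes> b) \<otimes> y" using ab y by (simp add: m_assoc)
      also have "\<dots> = a \<otimes> b" unfolding central[OF ab(2)] using ab y by (simp add: m_assoc)
      finally show ?thesis using both_outside[OF ab(1) n(1) ab(2) n(2)] n by (simp add: \<alpha>_def)
    qed
    show "\<alpha> (\<alpha> a) = a" if "a \<in> carrier G" for a
      using that mixed(2)[OF y(1), of a] y by (auto simp: \<alpha>_def m_assoc)
    show "\<alpha> a = a \<or> \<alpha> a = inv a" if a: "a \<in> carrier G" for a
    proof (cases "a \<in> A")
      case False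
      have "a \<otimes> y \<otimes> a = a \<otimes> a \<otimes> y" using a y central[OF a] by (simp add: m_assoc)
      then have "a \<otimes> y \<otimes> a = \<one>" using square[OF a False a False] y by simp
      then have "inv a = a \<otimes> y" using a y by (intro inv_equality) auto
      then show ?thesis using False by (simp add: \<alpha>_def)
    qed (simp add: \<alpha>_def)
    show "x \<in> carrier G" "\<alpha> x \<noteq> x" using A(3,4) y by (auto simp: \<alpha>_def)
  qed
qed

text \<open>
  If no recentred map moved a point \<open>x\<close> outside \<open>{x, x\<^sup>-\<^sup>1}\<close>, then \<open>f\<close> itself would be excluded by
  \<open>colour_preserving_map\<close>.
\<close>
lemma normalizer_gives_moving_map:
  assumes fin: "finite (carrier G)" and N: "N \<lhd> G"
    and S: "S \<subseteq> carrier G" "S = set_inv S"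
    and f: "f \<in> normalizer (cayley_aut G S) (right_regular G N)"
      "f \<noteq> \<one>\<^bsub>cayley_aut G S\<^esub>" "f \<one> = \<one>"
    and not_comm: "\<And>q. comm_group G \<Longrightarrow> q \<in> carrier G \<Longrightarrow> q \<otimes> q = \<one>"
    and not_dicyclic: "\<And>A x. \<not> dicyclic_decomposition A x"
  shows "\<exists>x\<in>carrier G. \<exists>y\<in>carrier G. \<exists>\<phi>\<in>endomorphisms_on N. y \<noteq> x \<and> y \<noteq> inv x \<and>
           (\<forall>n\<in>N. x \<otimes> n \<in> S \<longleftrightarrow> y \<otimes> \<phi> n \<in> S)"
proof -
  interpret N: normal N G by (rule N)
  have NG: "N \<subseteq> carrier G" by (rule N.subset)
  note normD = normalizer_right_regularD[OF S NG f(1)]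
  have fB: "f \<in> Bij (carrier G)"
    and pres: "\<And>x y. x \<in> carrier G \<Longrightarrow> y \<in> carrier G \<Longrightarrow> y \<otimes> inv x \<in> S \<longleftrightarrow> f y \<otimes> inv (f x) \<in> S"
    using normD(1) by (auto simp: cayley_aut_set_def)
  have fG: "f r \<in> carrier G" if "r \<in> carrier G" for r
    using that fB Bij_imp_funcset by blast
  have fN: "f n \<in> N" "f (r \<otimes> n) = f r \<otimes> f n" if n: "n \<in> N" and r: "r \<in> carrier G" for r n
  proof -
    obtain m where m: "m \<in> N" "\<And>r. r \<in> carrier G \<Longrightarrow> f (r \<otimes> n) = f r \<otimes> m" using normD(2)[OF n] by blast
    have "f n = m" using m(2)[of \<one>] m(1) n NG f(3) by auto
    then show "f n \<in> N" "f (r \<otimes> n) = f r \<otimes> f n" using m r by auto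
  qed
  obtain q where q: "q \<in> carrier G" "f q \<noteq> q"
  proof -
    have "\<not> (\<forall>q\<in>carrier G. f q = q)"
    proof
      assume id: "\<forall>q\<in>carrier G. f q = q"
      have "f = (\<lambda>x\<in>carrier G. x)"
        using id Bij_imp_extensional[OF fB] by (intro extensionalityI) auto
      then show False using f(2) cayley_aut_facts(4)[OF S] by simp
    qed
    then show ?thesis using that by blast
  qed
  have "\<exists>a\<in>carrier G. \<exists>b\<in>carrier G. f (a \<otimes> b) \<noteq> a \<otimes> f b \<and> f (a \<otimes> b) \<noteq> inv a \<otimes> f b"
  proof (rule ccontr)
    assume "\<not> ?thesis"
    then have colour: "f (a \<otimes> b) = a \<otimes> f b \<or> f (a \<otimes> b) = inv a \<otimes> f b"
      if "a \<in> carrier G" "b \<in> carrier G" for a b using that by blast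
    have "comm_group G" using colour_preserving_map[OF fin colour f(3) q] not_dicyclic by blast
    then have "inv q = q" using not_comm q(1) inv_equality by blast
    then show False using colour[OF q(1) one_closed] q f(3) by auto
  qed
  then obtain a b where ab: "a \<in> carrier G" "b \<in> carrier G"
    "f (a \<otimes> b) \<noteq> a \<otimes> f b" "f (a \<otimes> b) \<noteq> inv a \<otimes> f b" by blast
  \<comment> \<open>The recentred map moves \<open>a\<close> out of \<open>{a, a\<^sup>-\<^sup>1}\<close>. Because \<open>n b = b (b\<^sup>-\<^sup>1 n b)\<close>, its endomorphism of
    \<open>N\<close> is \<open>f\<close> between two conjugations, which preserve the normal subgroup \<open>N\<close>.\<close>
  define g where "g z = f (z \<otimes> b) \<otimes> inv (f b)" for z
  define conj where "conj n = inv b \<otimes> n \<otimes> b" for n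
  define \<phi> where "\<phi> = (\<lambda>n\<in>N. f b \<otimes> f (conj n) \<otimes> inv (f b))"
  have conjN: "conj n \<in> N" if "n \<in> N" for n
    using that ab(2) N.inv_op_closed1 by (simp add: conj_def)
  have g_pres: "z \<in> S \<longleftrightarrow> g z \<in> S" if z: "z \<in> carrier G" for z
    using pres[OF ab(2), of "z \<otimes> b"] z ab(2) by (simp add: g_def m_assoc)
  have g_mult: "g (r \<otimes> n) = g r \<otimes> \<phi> n" if n: "n \<in> N" and r: "r \<in> carrier G" for r n
  proof -
    have c: "n \<in> carrier G" "conj n \<in> carrier G" "f (conj n) \<in> carrier G" "f (r \<otimes> b) \<in> carrier G" "f b \<in> carrier G"
      using n r ab(2) conjN NG fG by (auto simp: conj_def)
    have "r \<otimes> n \<otimes> b = r \<otimes> b \<otimes> conj n" using n NG r ab(2) c by (simp add: conj_def m_assoc[symmetric]) (simp add: m_assoc)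
    then have "g (r \<otimes> n) = f (r \<otimes> b) \<otimes> f (conj n) \<otimes> inv (f b)"
      using fN(2)[OF conjN[OF n], of "r \<otimes> b"] r ab(2) by (simp add: g_def)
    also have "\<dots> = g r \<otimes> \<phi> n"
    proof -
      have "inv (f b) \<otimes> (f b \<otimes> (f (conj n) \<otimes> inv (f b))) = f (conj n) \<otimes> inv (f b)"
        using c by (simp add: m_assoc[symmetric])
      then show ?thesis using c n by (simp add: g_def \<phi>_def m_assoc)
    qed
    finally show ?thesis .
  qed
  have "\<phi> \<in> endomorphisms_on N"
  proof -
    have "\<phi> n \<in> N" if "n \<in> N" for n
      using that fN(1)[OF conjN] ab(2) fG N.inv_op_closed2 by (simp add: \<phi>_def)
    moreover have "\<phi> (m \<otimes> n) = \<phi> m \<otimes> \<phi> n" if mn: "m \<in> N" "n \<in> N" for m n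
    proof -
      have c: "m \<in> carrier G" "n \<in> carrier G" "f b \<in> carrier G" "conj m \<in> carrier G"
        "f (conj m) \<in> carrier G" "f (conj n) \<in> carrier G"
        using mn ab(2) conjN NG fG by (auto simp: conj_def)
      have "g m = \<phi> m" if "m \<in> N" for m
        using g_mult[OF that one_closed] that NG ab(2) c(3) \<open>\<And>n. n \<in> N \<Longrightarrow> \<phi> n \<in> N\<close>
        by (auto simp: g_def)
      then show ?thesis using g_mult[OF mn(2) c(1)] mn by simp
    qed
    ultimately show ?thesis by (auto simp: endomorphisms_on_def \<phi>_def)
  qed
  moreover have "a \<otimes> n \<in> S \<longleftrightarrow> g a \<otimes> \<phi> n \<in> S" if "n \<in> N" for n
    using that g_pres[of "a \<otimes> n"] g_mult[OF that ab(1)] ab(1) NG by auto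
  moreover have "g a \<in> carrier G" "g a \<noteq> a" "g a \<noteq> inv a"
    using ab fG by (auto simp: g_def inv_solve_right')
  ultimately show ?thesis using ab(1) by blast
qed

end

section \<open>The bounds\<close>

theorem theorem1p5:
  fixes R :: "('a, 'b) monoid_scheme" and N :: "'a set"
  assumes "group R" and "finite (carrier R)"
    and "N \<lhd> R" and "N \<noteq> {\<one>\<^bsub>R\<^esub>}" and "N \<noteq> carrier R"
  shows "real (card {S. S \<subseteq> carrier R \<and> S = set_inv\<^bsub>R\<^esub> S \<and>
            right_regular R (carrier R) =
              normalizer (cayley_aut R S) (right_regular R (carrier R)) \<and>
            (\<exists>f \<in> normalizer (cayley_aut R S) (right_regular R N).
               f \<noteq> \<one>\<^bsub>cayley_aut R S\<^esub> \<and> f \<one>\<^bsub>R\<^esub> = \<one>\<^bsub>R\<^esub>)})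
         \<le> 2 powr (c_value R - real (card N) / 96 + 2 * log 2 (real (order R))
                    + (log 2 (real (order R)))\<^sup>2 + 3)
       \<and> (\<not> (comm_group R \<and> group_exponent R > 2) \<and> \<not> generalised_dicyclic R \<longrightarrow>
         real (card {S. S \<subseteq> carrier R \<and> S = set_inv\<^bsub>R\<^esub> S \<and>
            (\<exists>f \<in> normalizer (cayley_aut R S) (right_regular R N).
               f \<noteq> \<one>\<^bsub>cayley_aut R S\<^esub> \<and> f \<one>\<^bsub>R\<^esub> = \<one>\<^bsub>R\<^esub>)})
         \<le> 2 powr (c_value R - real (card N) / 96 + 2 * log 2 (real (order R))
                    + (log 2 (real (order R)))\<^sup>2 + 3))"
    (is "real (card ?F1) \<le> ?bound \<and> (?generic \<longrightarrow> real (card ?F2) \<le> ?bound)")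
proof -
  interpret R: group R by (rule assms(1))
  show ?thesis
  proof (cases "(\<exists>A x. R.dicyclic_decomposition A x) \<or>
      (comm_group R \<and> (\<exists>q\<in>carrier R. q \<otimes>\<^bsub>R\<^esub> q \<noteq> \<one>\<^bsub>R\<^esub>))")
    case True
    then have "?F1 = {}"
      using R.dicyclic_not_self_normalizing R.comm_group_not_self_normalizing by blast
    moreover have "\<not> ?generic"
      using True R.dicyclic_decomposition_imp_generalised_dicyclic[OF assms(2)]
        R.group_exponent_gt_2[OF assms(2)] by blast
    ultimately show ?thesis by (simp only: card.empty) simp
  next
    case False
    define F where "F = {S. S \<subseteq> carrier R \<and> S = set_inv\<^bsub>R\<^esub> S \<and>
            (\<exists>x\<in>carrier R. \<exists>y\<in>carrier R. \<exists>\<phi>\<in>R.endomorphisms_on N.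
               y \<noteq> x \<and> y \<noteq> inv\<^bsub>R\<^esub> x \<and> (\<forall>n\<in>N. x \<otimes>\<^bsub>R\<^esub> n \<in> S \<longleftrightarrow> y \<otimes>\<^bsub>R\<^esub> \<phi> n \<in> S))}"
    have F2: "?F2 \<subseteq> F"
    proof
      fix S assume "S \<in> ?F2"
      then obtain f where S: "S \<subseteq> carrier R" "S = set_inv\<^bsub>R\<^esub> S"
        and f: "f \<in> normalizer (cayley_aut R S) (right_regular R N)"
          "f \<noteq> \<one>\<^bsub>cayley_aut R S\<^esub>" "f \<one>\<^bsub>R\<^esub> = \<one>\<^bsub>R\<^esub>" by auto
      have "\<exists>x\<in>carrier R. \<exists>y\<in>carrier R. \<exists>\<phi>\<in>R.endomorphisms_on N. y \<noteq> x \<and> y \<noteq> inv\<^bsub>R\<^esub> x \<and>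
               (\<forall>n\<in>N. x \<otimes>\<^bsub>R\<^esub> n \<in> S \<longleftrightarrow> y \<otimes>\<^bsub>R\<^esub> \<phi> n \<in> S)"
        using False by (intro R.normalizer_gives_moving_map[OF assms(2,3) S f]) auto
      then show "S \<in> F" unfolding F_def by (intro CollectI conjI S)
    qed
    have F1: "?F1 \<subseteq> ?F2" by (intro Collect_mono impI, elim conjE, intro conjI)
    have finF: "finite F"
      by (rule finite_subset[of _ "Pow (carrier R)"]) (use assms(2) in \<open>auto simp: F_def\<close>)
    have "card ?F1 \<le> card F" "card ?F2 \<le> card F"
      using card_mono[OF finF subset_trans[OF F1 F2]] card_mono[OF finF F2] .
    moreover have "real (card F) \<le> ?bound"
    proof -
      have "real (card F) \<le> 2 powr (c_value R - real (card N) / 80 + 2 * log 2 (real (order R))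
                    + (log 2 (real (order R)))\<^sup>2)"
        unfolding F_def
        by (rule R.card_sets_with_moving_map[OF normal_imp_subgroup[OF assms(3)] assms(2)])
      also have "\<dots> \<le> ?bound" by (rule powr_mono) auto
      finally show ?thesis .
    qed
    ultimately show ?thesis by linarith
  qed
qed

end
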